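(* Let $N,d\geq1$ and $m=\lceil N/2\rceil$. Let $\{\mathcal{X}_k\}$ be a finite sequence of independent random tensors in $\mathbb{T}_{N,d}$ such that, for some constant $L\geq0$, $\mathbb{E}(\mathcal{X}_k)=\mathcal{O}$ and $\|\mathcal{X}_k\|^{\bar E}\leq L$ for all $k$. Let $\mathcal{Y}=\sum_k\mathcal{X}_k$, and let $\mathcal{V}_1\in\mathbb{T}_{2m,d}$ and $\mathcal{V}_2\in\mathbb{T}_{2(N-m),d}$ be Einstein-symmetric tensors with $\mathcal{V}_1\succeq^E\mathbb{E}(\mathcal{Y}\,\bar{*}\,\mathcal{Y})=\sum_k\mathbb{E}(\mathcal{X}_k\,\bar{*}\,\mathcal{X}_k)$ and $\mathcal{V}_2\succeq^E\mathbb{E}(\mathcal{Y}\,\underline{*}\,\mathcal{Y})=\sum_k\mathbb{E}(\mathcal{X}_k\,\underline{*}\,\mathcal{X}_k).$ Let $\nu(\mathcal{Y})=\max\{\|\mathcal{V}_1\|^E,\|\mathcal{V}_2\|^E\}$, assumed positive, and $d_{\mathcal{V}}(\mathcal{Y})=\frac{1}{\nu(\mathcal{Y})}\big(\mathrm{tr}^E(\mathcal{V}_1)+\mathrm{tr}^E(\mathcal{V}_2)\big)$. Then for all $t\geq\sqrt{\nu(\mathcal{Y})}+L/3$, $\mathbb{P}\big(\|\mathcal{Y}\|^{\bar E}\geq t\big)\leq4\,d_{\mathcal{V}}(\mathcal{Y})\exp\!\left(\frac{-t^2/2}{\nu(\mathcal{Y})+Lt/3}\right).$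
   Context: $\mathbb{T}_{N,d}$ is the set of real tensors of order $N$ with indices in $\{1,\ldots,d\}$. With $m=\lceil N/2\rceil$: $(\mathcal{A}\,\bar{*}\,\mathcal{B})_{i_1\ldots i_mj_1\ldots j_m}=\sum_{k_1,\ldots,k_{N-m}}a_{i_1\ldots i_mk_1\ldots k_{N-m}}b_{j_1\ldots j_mk_1\ldots k_{N-m}}\in\mathbb{T}_{2m,d}$ and $(\mathcal{A}\,\underline{*}\,\mathcal{B})_{k_1\ldots k_{N-m}k'_1\ldots k'_{N-m}}=\sum_{i_1,\ldots,i_m}a_{i_1\ldots i_mk_1\ldots k_{N-m}}b_{i_1\ldots i_mk'_1\ldots k'_{N-m}}\in\mathbb{T}_{2(N-m),d}$. For $\mathcal{C}\in\mathbb{T}_{2p,d}$ Einstein-symmetric ($c_{i_1\ldots i_pj_1\ldots j_p}=c_{j_1\ldots j_pi_1\ldots i_p}$), the Einstein-eigenvalues are the eigenvalues of the symmetric matrix $f(\mathcal{C})\in\mathbb{R}^{d^p\times d^p}$, $f(\mathcal{C})_{ij}=c_{i_1\ldots i_pj_1\ldots j_p}$ with $i=i_1+\sum_{l=2}^p(i_l-1)d^{l-1}$, $j$ likewise (equivalently the diagonal entries of $\mathcal{D}$ in an Einstein eigenvalue decomposition); $\|\mathcal{C}\|^E$ is their maximum absolute value and $\mathrm{tr}^E(\mathcal{C})$ their sum. $\mathcal{C}$ is Einstein-positive semi-definite if all Einstein-eigenvalues are nonnegative, and $\mathcal{A}\succeq^E\mathcal{B}$ means $\mathcal{A}-\mathcal{B}$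 is Einstein-positive semi-definite. The generalized spectral norm is $\|\mathcal{A}\|^{\bar E}=\sqrt{\|\mathcal{A}\,\bar{*}\,\mathcal{A}\|^E}$. Random tensors are measurable maps from a probability space into $\mathbb{T}_{N,d}$; expectation is entrywise; $\mathcal{O}$ is the zero tensor. *)

theory Defs
  imports "HOL-Probability.Probability" "Jordan_Normal_Form.Char_Poly"
begin

text \<open>Tensors of order n with indices in {0..<d} (0-based version of {1..d}),
 represented as functions on index lists; only entries indexed by tidx n d matter.\<close>
type_synonym tensor = "nat list \<Rightarrow> real"

definition tidx :: "nat \<Rightarrow> nat \<Rightarrow> nat list set" where
  "tidx n d = {is. length is = n \<and> set is \<subseteq> {..<d}}"

definition half_up :: "nat \<Rightarrow> nat" where "half_up N = (N + 1) div 2"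

definition ebar :: "nat \<Rightarrow> nat \<Rightarrow> tensor \<Rightarrow> tensor \<Rightarrow> tensor" where
  "ebar N d A B = (\<lambda>xs. \<Sum>ks\<in>tidx (N - half_up N) d.
      A (take (half_up N) xs @ ks) * B (drop (half_up N) xs @ ks))"

definition eunder :: "nat \<Rightarrow> nat \<Rightarrow> tensor \<Rightarrow> tensor \<Rightarrow> tensor" where
  "eunder N d A B = (\<lambda>xs. \<Sum>is\<in>tidx (half_up N) d.
      A (is @ take (N - half_up N) xs) * B (is @ drop (N - half_up N) xs))"

text \<open>Digits of a linear index: i = i_1 + sum (i_l - 1) d^(l-1), 0-based.\<close>
definition idx_digits :: "nat \<Rightarrow> nat \<Rightarrow> nat \<Rightarrow> nat list" where
  "idx_digits d p i = map (\<lambda>l. i div d ^ l mod d) [0..<p]"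

definition unfold_mat :: "nat \<Rightarrow> nat \<Rightarrow> tensor \<Rightarrow> real mat" where
  "unfold_mat p d C = mat (d ^ p) (d ^ p) (\<lambda>(i, j). C (idx_digits d p i @ idx_digits d p j))"

definition einstein_sym :: "nat \<Rightarrow> nat \<Rightarrow> tensor \<Rightarrow> bool" where
  "einstein_sym p d C = (\<forall>is\<in>tidx p d. \<forall>js\<in>tidx p d. C (is @ js) = C (js @ is))"

definition e_eigs :: "nat \<Rightarrow> nat \<Rightarrow> tensor \<Rightarrow> real multiset" where
  "e_eigs p d C = proots (char_poly (unfold_mat p d C))"

definition e_norm :: "nat \<Rightarrow> nat \<Rightarrow> tensor \<Rightarrow> real" where
  "e_norm p d C = Max (abs ` set_mset (e_eigs p d C))"

definition e_trace :: "nat \<Rightarrow> nat \<Rightarrow> tensor \<Rightarrow> real" where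
  "e_trace p d C = sum_mset (e_eigs p d C)"

definition e_psd :: "nat \<Rightarrow> nat \<Rightarrow> tensor \<Rightarrow> bool" where
  "e_psd p d C = (\<forall>x\<in># e_eigs p d C. 0 \<le> x)"

definition e_geq :: "nat \<Rightarrow> nat \<Rightarrow> tensor \<Rightarrow> tensor \<Rightarrow> bool" where
  "e_geq p d A B = e_psd p d (\<lambda>xs. A xs - B xs)"

definition gen_norm :: "nat \<Rightarrow> nat \<Rightarrow> tensor \<Rightarrow> real" where
  "gen_norm N d A = sqrt (e_norm (half_up N) d (ebar N d A A))"

definition texp :: "'w measure \<Rightarrow> ('w \<Rightarrow> tensor) \<Rightarrow> tensor" where
  "texp M X = (\<lambda>xs. integral\<^sup>L M (\<lambda>w. X w xs))"

end

theory Submission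
  imports Defs
begin

text \<open>
  Write \<open>Y\<close> for the random tensor, \<open>V\<close> for the block diagonal kernel of the two given
  tensors and \<open>\<nu>\<close> for its norm.  The self-adjoint dilation of \<open>Y\<close> is a symmetric kernel whose
  largest eigenvalue is the generalized spectral norm and whose square is block diagonal, the
  blocks being the two contractions of \<open>Y\<close> with itself.  Markov's inequality for
  \<open>tr (exp (\<theta> Y) - \<theta> Y - 1)\<close> reduces the claim to
  \<open>E tr (exp (\<theta> Y)) \<le> tr (exp (g V))\<close>; the chord bound
  \<open>exp (g x) - 1 \<le> (x / \<nu>) (exp (g \<nu>) - 1)\<close> on \<open>[0, \<nu>]\<close> then produces the intrinsic
  dimension, and \<open>exp x \<le> 4 (exp x - x - 1)\<close> for \<open>x \<ge> 1\<close> the factor 4.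

  The trace inequality is obtained one independent summand \<open>X\<close> at a time.  Instead of Lieb's
  concavity theorem and operator monotonicity of the logarithm, a supporting hyperplane of the
  jointly convex relative entropy is used, taken at \<open>T0 = E (exp (H + \<theta> X))\<close> and
  \<open>A0 = 1 + g E (X\<^sup>2)\<close>: the coefficient of \<open>A\<close> is negative semidefinite, so the
  bound \<open>exp (\<theta> X) \<le> 1 + \<theta> X + g X\<^sup>2\<close> can be inserted before taking expectations.
\<close>

section \<open>Spectral theorem for symmetric kernels\<close>

text \<open>The obstacle is that \<open>H\<close> and \<open>X\<close> do not commute, so
  \<open>tr (exp (H + \<theta> X))\<close> does not factor, and the exponential cannot be averaged
  over \<open>X\<close> alone. A fixed linear minorant of the entropy removes the dependence on the
  sample: afterwards \<open>exp (H + \<theta> X)\<close>, \<open>X\<close> and \<open>X^2\<close>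
  occur only linearly. The mean of the exponential is \<open>T0\<close>, and the mean of
  \<open>1 + \<theta> X + g X^2\<close> is \<open>A0\<close> because \<open>X\<close> has mean zero.
  These form exactly the point where the hyperplane touches, so averaging the minorant loses
  nothing.

  Subtracting \<open>\<theta> Y\<close> in Markov's inequality is free since \<open>Y\<close> has
  mean zero, and it makes the function nonnegative on the whole spectrum. Subtracting 1 makes a zero
  eigenvalue contribute zero, which is why the trace of \<open>V\<close> appears in place of the
  number of coordinates.

  Kernels are functions on an arbitrary finite index set, so the dilation can live on a disjoint sum
  without renumbering. Matrices with numbered rows enter only where eigenvalues are defined by a
  characteristic polynomial.\<close>

definition ip :: "'i set \<Rightarrow> ('i \<Rightarrow> real) \<Rightarrow> ('i \<Rightarrow> real) \<Rightarrow> real" where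
  "ip I u v = (\<Sum>x\<in>I. u x * v x)"

definition mv :: "'i set \<Rightarrow> ('i \<Rightarrow> 'i \<Rightarrow> real) \<Rightarrow> ('i \<Rightarrow> real) \<Rightarrow> 'i \<Rightarrow> real" where
  "mv I A v = (\<lambda>x. \<Sum>y\<in>I. A x y * v y)"

definition bil :: "'i set \<Rightarrow> ('i \<Rightarrow> 'i \<Rightarrow> real) \<Rightarrow> ('i \<Rightarrow> real) \<Rightarrow> ('i \<Rightarrow> real) \<Rightarrow> real" where
  "bil I A u v = (\<Sum>x\<in>I. \<Sum>y\<in>I. A x y * u x * v y)"

definition orthonormal_on :: "'i set \<Rightarrow> 'j set \<Rightarrow> ('j \<Rightarrow> 'i \<Rightarrow> real) \<Rightarrow> bool" where
  "orthonormal_on I J U \<longleftrightarrow> (\<forall>i\<in>J. \<forall>j\<in>J. ip I (U i) (U j) = (if i = j then 1 else 0))"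

definition symmetric_on :: "'i set \<Rightarrow> ('i \<Rightarrow> 'i \<Rightarrow> real) \<Rightarrow> bool" where
  "symmetric_on I A \<longleftrightarrow> (\<forall>x\<in>I. \<forall>y\<in>I. A x y = A y x)"

text \<open>A spectral decomposition in outer-product form. The eigenvectors are numbered by
  \<open>I\<close> itself, so no ordering is chosen and their number is right by construction. A
  function of \<open>A\<close> keeps \<open>U\<close> and changes only \<open>a\<close>.\<close>

definition eigsys :: "'i set \<Rightarrow> ('i \<Rightarrow> 'i \<Rightarrow> real) \<Rightarrow> ('i \<Rightarrow> 'i \<Rightarrow> real) \<Rightarrow> ('i \<Rightarrow> real) \<Rightarrow> bool" where
  "eigsys I A U a \<longleftrightarrow> finite I \<and> orthonormal_on I I U \<and>
     (\<forall>x\<in>I. \<forall>y\<in>I. A x y = (\<Sum>i\<in>I. a i * U i x * U i y))"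

section \<open>Elementary rules for inner products and forms\<close>

lemma ip_commute: "ip I u v = ip I v u"
  by (simp add: ip_def mult.commute)

lemma ip_add_right: "ip I u (\<lambda>x. v x + w x) = ip I u v + ip I u w"
  by (simp add: ip_def algebra_simps sum.distrib)

lemma ip_diff_right: "ip I u (\<lambda>x. v x - w x) = ip I u v - ip I u w"
  by (simp add: ip_def algebra_simps sum_subtractf)

lemma ip_scale_right: "ip I u (\<lambda>x. c * v x) = c * ip I u v"
  by (simp add: ip_def sum_distrib_left algebra_simps)

lemma ip_sum_right: "ip I u (\<lambda>x. \<Sum>j\<in>J. f j x) = (\<Sum>j\<in>J. ip I u (f j))"
  by (simp add: ip_def sum_distrib_left sum.swap[of _ J I])

lemma ip_self_nonneg: "0 \<le> ip I u u"
  by (simp add: ip_def sum_nonneg)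

lemma ip_self_eq_0: "finite I \<Longrightarrow> ip I u u = 0 \<Longrightarrow> x \<in> I \<Longrightarrow> u x = 0"
  by (simp add: ip_def sum_nonneg_eq_0_iff)

lemma bil_eq_ip: "bil I A u v = ip I u (mv I A v)"
  by (simp add: bil_def ip_def mv_def sum_distrib_left mult_ac)

lemma bil_sym: "symmetric_on I A \<Longrightarrow> bil I A u v = bil I A v u"
  unfolding bil_def
  by (subst sum.swap) (auto intro!: sum.cong simp: symmetric_on_def mult_ac)

lemma ip_cong: "(\<And>x. x \<in> I \<Longrightarrow> u x = u' x) \<Longrightarrow> (\<And>x. x \<in> I \<Longrightarrow> v x = v' x) \<Longrightarrow> ip I u v = ip I u' v'"
  by (simp add: ip_def)

text \<open>Dimension counting without linear algebra: the residuals of the unit vectors have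
  total squared length \<open>card I - card J\<close>.\<close>
lemma residual_unit_vectors:
  fixes U :: "'j \<Rightarrow> 'i \<Rightarrow> real"
  assumes "finite I" "finite J" and U: "orthonormal_on I J U"
  defines "r \<equiv> \<lambda>x y. (if x = y then 1 else 0) - (\<Sum>j\<in>J. U j x * U j y)"
  shows "\<And>j x. j \<in> J \<Longrightarrow> x \<in> I \<Longrightarrow> ip I (U j) (r x) = 0"
    and "(\<Sum>x\<in>I. ip I (r x) (r x)) = real (card I) - real (card J)"
proof -
  have e: "ip I u (\<lambda>y. if x = y then 1 else 0) = u x" if "x \<in> I" for u x
    unfolding ip_def using that assms(1) by (simp add: if_distrib cong: if_cong)
  have rr: "ip I u (r x) = u x - (\<Sum>j\<in>J. U j x * ip I u (U j))" if "x \<in> I" for u x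
    unfolding r_def by (simp add: ip_diff_right ip_sum_right ip_scale_right e[OF that])
  show z: "ip I (U j) (r x) = 0" if "j \<in> J" "x \<in> I" for j x
  proof -
    have "(\<Sum>i\<in>J. U i x * ip I (U j) (U i)) = (\<Sum>i\<in>J. if i = j then U i x else 0)"
      using U that by (intro sum.cong) (auto simp: orthonormal_on_def)
    then show ?thesis using rr[OF that(2)] that assms(2) by simp
  qed
  have "ip I (r x) (r x) = 1 - (\<Sum>j\<in>J. U j x * U j x)" if "x \<in> I" for x
  proof -
    have "ip I (r x) (r x) = r x x - (\<Sum>j\<in>J. U j x * ip I (r x) (U j))" by (rule rr[OF that])
    also have "(\<Sum>j\<in>J. U j x * ip I (r x) (U j)) = 0"
      using z[OF _ that] by (simp add: ip_commute[of I "r x"])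
    finally show ?thesis by (simp add: r_def)
  qed
  then have "(\<Sum>x\<in>I. ip I (r x) (r x)) = real (card I) - (\<Sum>j\<in>J. ip I (U j) (U j))"
    by (simp add: sum_subtractf ip_def sum.swap[of _ J I])
  also have "(\<Sum>j\<in>J. ip I (U j) (U j)) = real (card J)"
    using U by (simp add: orthonormal_on_def)
  finally show "(\<Sum>x\<in>I. ip I (r x) (r x)) = real (card I) - real (card J)" .
qed

text \<open>With as many vectors as coordinates the total squared residual is 0, so every residual
  vanishes: for a square kernel, orthonormal rows force orthonormal columns.\<close>

lemma orthonormal_complete:
  assumes "finite I" "orthonormal_on I I U" "x \<in> I" "y \<in> I"
  shows "(\<Sum>i\<in>I. U i x * U i y) = (if x = y then 1 else 0)"
proof -
  define r where "r = (\<lambda>x y. (if x = y then 1 else 0) - (\<Sum>j\<in>I. U j x * U j y))"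
  have "(\<Sum>x\<in>I. ip I (r x) (r x)) = 0"
    using residual_unit_vectors(2)[OF assms(1,1,2)] by (simp add: r_def)
  then have "ip I (r x) (r x) = 0"
    using assms by (simp add: sum_nonneg_eq_0_iff ip_self_nonneg)
  then have "r x y = 0" using ip_self_eq_0 assms by metis
  then show ?thesis by (simp add: r_def)
qed

text \<open>With fewer vectors than coordinates the total squared residual is positive, so some unit
  vector has a nonzero residual, which can be normalized.\<close>

lemma exists_unit_orthogonal:
  assumes "finite I" "finite J" "card J < card I" "orthonormal_on I J U"
  obtains v where "\<And>x. x \<notin> I \<Longrightarrow> v x = 0" "ip I v v = 1" "\<And>j. j \<in> J \<Longrightarrow> ip I (U j) v = 0"
proof -
  define r where "r = (\<lambda>x y. (if x = y then 1 else 0) - (\<Sum>j\<in>J. U j x * U j y))"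
  have "(\<Sum>x\<in>I. ip I (r x) (r x)) > 0"
    using residual_unit_vectors(2)[OF assms(1,2,4)] assms(3) by (simp add: r_def)
  then obtain x where x: "x \<in> I" "ip I (r x) (r x) \<noteq> 0"
    by (metis (no_types, lifting) less_irrefl sum.neutral)
  define c where "c = sqrt (ip I (r x) (r x))"
  have c: "c > 0" "c * c = ip I (r x) (r x)"
    using x(2) ip_self_nonneg[of I "r x"] by (auto simp: c_def)
  \<comment> \<open>The cutoff outside \<open>I\<close> puts \<open>v\<close> into the compact set
    over which the quadratic form is minimized later.\<close>
  define v where "v = (\<lambda>y. if y \<in> I then r x y / c else 0)"
  have 1: "ip I u v = ip I u (r x) / c" for u
    by (simp add: ip_def v_def sum_divide_distrib)
  have "ip I v v = ip I (r x) v / c" by (simp only: 1[of v] ip_commute[of I v "r x"])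
  then have 2: "ip I v v = 1"
    using c(1) by (simp add: 1 c(2)[symmetric])
  have 3: "ip I (U j) v = 0" if "j \<in> J" for j
    using residual_unit_vectors(1)[OF assms(1,2,4) that x(1)] by (simp add: 1 r_def)
  show thesis by (rule that[OF _ 2 3]) (simp_all add: v_def)
qed

text \<open>The first-order condition at a minimum. If \<open>b\<close> were nonzero, the test value
  \<open>s = - b / k\<close> with \<open>k > \<bar>c\<bar>\<close> would make the expression
  negative.\<close>

lemma quadratic_nonneg_linear_zero:
  fixes b c :: real
  assumes "\<And>s. 0 \<le> 2 * s * b + s\<^sup>2 * c"
  shows "b = 0"
proof (rule ccontr)
  assume b: "b \<noteq> 0"
  define k where "k = \<bar>c\<bar> + 1"
  have k: "k > 0" "c < k" by (auto simp: k_def)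
  have "0 \<le> 2 * (- b / k) * b + (- b / k)\<^sup>2 * c" by (rule assms)
  also have "\<dots> = (b\<^sup>2 / k\<^sup>2) * (c - 2 * k)"
    using k by (simp add: field_simps power2_eq_square)
  also have "\<dots> < 0" using b k by (intro mult_pos_neg) auto
  finally show False by simp
qed

lemma exists_minimizing_unit_vector:
  fixes A :: "'i \<Rightarrow> 'i \<Rightarrow> real"
  assumes "finite I" "finite J" "card J < card I" "orthonormal_on I J U"
  obtains v where "ip I v v = 1" "\<And>j. j \<in> J \<Longrightarrow> ip I (U j) v = 0"
    "\<And>w. (\<And>j. j \<in> J \<Longrightarrow> ip I (U j) w = 0) \<Longrightarrow> bil I A v v * ip I w w \<le> bil I A w w"
proof -
  \<comment> \<open>The type \<open>'i\<close> may be infinite. Pinning all coordinates outside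
    \<open>I\<close> to 0 makes the box a product of compact sets over the whole type, hence
    compact.\<close>
  define B where "B = (PiE UNIV (\<lambda>x. if x \<in> I then {-1..1::real} else {0}))"
  define K where "K = B \<inter> ({v. ip I v v = 1} \<inter> (\<Inter>j\<in>J. {v. ip I (U j) v = 0}))"
  have "compactin (product_topology (\<lambda>i. euclidean) UNIV) B"
    unfolding B_def by (subst compactin_PiE) auto
  then have "compact B"
    by (simp add: euclidean_product_topology)
  moreover have coord: "continuous_on UNIV (\<lambda>v::'i\<Rightarrow>real. v x)" for x
    by (rule continuous_on_product_coordinates)
  have "closed {v::'i\<Rightarrow>real. ip I v v = 1}"
    unfolding ip_def by (intro closed_Collect_eq continuous_intros coord)
  moreover have "closed (\<Inter>j\<in>J. {v. ip I (U j) v = 0})"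
    unfolding ip_def by (intro closed_INT ballI closed_Collect_eq continuous_intros coord)
  ultimately have K: "compact K"
    unfolding K_def by (intro compact_Int_closed closed_Int)
  have inK: "v \<in> K" if v: "\<And>x. x \<notin> I \<Longrightarrow> v x = 0" "ip I v v = 1"
      "\<And>j. j \<in> J \<Longrightarrow> ip I (U j) v = 0" for v
  proof -
    have "v x \<in> {-1..1}" if "x \<in> I" for x
    proof -
      have "v x * v x \<le> ip I v v"
        unfolding ip_def using that assms(1) by (intro member_le_sum) auto
      then have "(v x)\<^sup>2 \<le> 1" using v(2) by (simp add: power2_eq_square)
      then show ?thesis by (simp add: abs_square_le_1 abs_le_iff)
    qed
    then show ?thesis using v by (auto simp: K_def B_def)
  qed
  obtain v0 where "\<And>x. x \<notin> I \<Longrightarrow> v0 x = 0" "ip I v0 v0 = 1" "\<And>j. j \<in> J \<Longrightarrow> ip I (U j) v0 = 0"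
    using exists_unit_orthogonal[OF assms] by blast
  then have "v0 \<in> K" by (rule inK)
  then have "K \<noteq> {}" by auto
  moreover have "continuous_on K (\<lambda>v. bil I A v v)"
    unfolding bil_def by (intro continuous_intros continuous_on_subset[OF coord]) auto
  ultimately obtain v where v: "v \<in> K" "\<And>w. w \<in> K \<Longrightarrow> bil I A v v \<le> bil I A w w"
    using continuous_attains_inf[OF K] by blast
  \<comment> \<open>Both sides are homogeneous of degree 2, so the bound passes from unit vectors to
    all admissible \<open>w\<close>.\<close>
  have "bil I A v v * ip I w w \<le> bil I A w w" if w: "\<And>j. j \<in> J \<Longrightarrow> ip I (U j) w = 0" for w
  proof (cases "ip I w w = 0")
    case True
    then have "w x = 0" if "x \<in> I" for x using ip_self_eq_0 assms(1) that by metis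
    then have "bil I A w w = 0" by (simp add: bil_def)
    then show ?thesis using True by simp
  next
    case False
    define c where "c = sqrt (ip I w w)"
    have c: "c > 0" "c * c = ip I w w"
      using False ip_self_nonneg[of I w] by (auto simp: c_def)
    define w' where "w' = (\<lambda>y. if y \<in> I then w y / c else 0)"
    have 1: "ip I u w' = ip I u w / c" for u
      by (simp add: ip_def w'_def sum_divide_distrib)
    have "ip I w' w' = ip I w w' / c" by (simp only: 1[of w'] ip_commute[of I w' w])
    then have "ip I w' w' = 1" using c(1) by (simp add: 1 c(2)[symmetric])
    then have "w' \<in> K"
      by (rule inK[rotated]) (simp_all only: 1 w, simp_all add: w'_def)
    then have "bil I A v v \<le> bil I A w' w'" by (rule v(2))
    also have "bil I A w' w' = bil I A w w / (c * c)"
      by (simp add: bil_def w'_def sum_divide_distrib)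
    also have "c * c = ip I w w" by (rule c(2))
    finally show ?thesis using False ip_self_nonneg[of I w] by (simp add: field_simps)
  qed
  with v(1) that show thesis by (auto simp: K_def)
qed

text \<open>The residual \<open>h = A v - l v\<close> of the minimizer is itself orthogonal to all
  \<open>U j\<close>, by symmetry of \<open>A\<close>. Hence \<open>v + s h\<close> is an admissible
  perturbation for every \<open>s\<close>, and the linear coefficient of the resulting quadratic in
  \<open>s\<close> is twice the squared length of \<open>h\<close>, which must therefore
  vanish.\<close>

lemma exists_eigenvector_orthogonal:
  fixes A :: "'i \<Rightarrow> 'i \<Rightarrow> real"
  assumes "finite I" "finite J" "card J < card I" "orthonormal_on I J U" "symmetric_on I A"
    and eig: "\<And>j x. j \<in> J \<Longrightarrow> x \<in> I \<Longrightarrow> mv I A (U j) x = a j * U j x"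
  obtains v l where "ip I v v = 1" "\<And>j. j \<in> J \<Longrightarrow> ip I (U j) v = 0"
    "\<And>x. x \<in> I \<Longrightarrow> mv I A v x = l * v x"
proof -
  obtain v where v: "ip I v v = 1" "\<And>j. j \<in> J \<Longrightarrow> ip I (U j) v = 0"
    "\<And>w. (\<And>j. j \<in> J \<Longrightarrow> ip I (U j) w = 0) \<Longrightarrow> bil I A v v * ip I w w \<le> bil I A w w"
    using exists_minimizing_unit_vector[OF assms(1-4)] by blast
  define l where "l = bil I A v v"
  define h where "h = (\<lambda>x. mv I A v x - l * v x)"
  have hJ: "ip I (U j) h = 0" if "j \<in> J" for j
  proof -
    have "ip I (U j) (mv I A v) = ip I v (mv I A (U j))"
      by (metis bil_eq_ip bil_sym assms(5))
    also have "\<dots> = ip I v (\<lambda>x. a j * U j x)"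
      using eig[OF that] by (intro ip_cong) auto
    also have "\<dots> = 0" using v(2)[OF that] by (simp add: ip_scale_right ip_commute[of I v])
    finally show ?thesis using v(2)[OF that] by (simp add: h_def ip_diff_right ip_scale_right)
  qed
  have "0 \<le> 2 * s * ip I h h + s\<^sup>2 * (bil I A h h - l * ip I h h)" for s
  proof -
    define w where "w = (\<lambda>x. v x + s * h x)"
    have "l * ip I w w \<le> bil I A w w"
      unfolding l_def by (rule v(3)) (simp add: w_def ip_add_right ip_scale_right v(2) hJ)
    moreover have "ip I w w = 1 + 2 * s * ip I h v + s\<^sup>2 * ip I h h"
      unfolding v(1)[symmetric] by (simp add: w_def ip_def algebra_simps sum.distrib sum_distrib_left power2_eq_square)
    moreover have "bil I A w w = l + s * (bil I A h v + bil I A v h) + s\<^sup>2 * bil I A h h"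
      by (simp add: w_def l_def bil_def algebra_simps sum.distrib sum_distrib_left power2_eq_square)
    moreover have "bil I A v h = bil I A h v" by (rule bil_sym[OF assms(5)])
    moreover have "bil I A h v = ip I h h + l * ip I h v"
      by (simp add: bil_eq_ip ip_scale_right[symmetric] ip_add_right[symmetric]) (simp add: h_def)
    ultimately show ?thesis by (simp add: algebra_simps)
  qed
  then have "ip I h h = 0" by (rule quadratic_nonneg_linear_zero)
  then have "h x = 0" if "x \<in> I" for x using ip_self_eq_0 assms(1) that by metis
  then have "mv I A v x = l * v x" if "x \<in> I" for x using that by (simp add: h_def)
  with v(1,2) that show thesis by blast
qed

theorem spectral_theorem:
  fixes A :: "'i \<Rightarrow> 'i \<Rightarrow> real"
  assumes fin: "finite I" and sym: "symmetric_on I A"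
  obtains U a where "eigsys I A U a"
proof -
  have ex: "\<exists>U a. orthonormal_on I J U \<and> (\<forall>j\<in>J. \<forall>x\<in>I. mv I A (U j) x = a j * U j x)" if "J \<subseteq> I" for J
    using finite_subset[OF that fin] that
  proof (induction J rule: finite_induct)
    case empty
    then show ?case by (simp add: orthonormal_on_def)
  next
    case (insert k J)
    then obtain U a where U: "orthonormal_on I J U"
      and a: "\<And>j x. j \<in> J \<Longrightarrow> x \<in> I \<Longrightarrow> mv I A (U j) x = a j * U j x" by blast
    have "card (insert k J) \<le> card I" using insert.prems fin by (metis card_mono)
    then have less: "card J < card I" using insert by simp
    obtain v l where v: "ip I v v = 1" "\<And>j. j \<in> J \<Longrightarrow> ip I (U j) v = 0"
        "\<And>x. x \<in> I \<Longrightarrow> mv I A v x = l * v x"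
      using exists_eigenvector_orthogonal[OF fin insert.hyps(1) less U sym a] by blast
    have "ip I v (U j) = 0" if "j \<in> J" for j using v(2)[OF that] by (simp add: ip_def mult.commute)
    then have "orthonormal_on I (insert k J) (U(k := v))"
      using U v(1,2) insert.hyps(2) unfolding orthonormal_on_def by auto
    moreover have "\<forall>j\<in>insert k J. \<forall>x\<in>I. mv I A ((U(k := v)) j) x = (a(k := l)) j * (U(k := v)) j x"
      using a v(3) insert.hyps(2) by auto
    ultimately show ?case by blast
  qed
  from ex[OF subset_refl] obtain U a where U: "orthonormal_on I I U"
    and a: "\<And>j x. j \<in> I \<Longrightarrow> x \<in> I \<Longrightarrow> mv I A (U j) x = a j * U j x" by blast
  have "A x y = (\<Sum>i\<in>I. a i * U i x * U i y)" if "x \<in> I" "y \<in> I" for x y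
  proof -
    \<comment> \<open>Multiplication by the identity, written as the completeness relation of the
      eigenvectors.\<close>
    have "A x y = (\<Sum>z\<in>I. A x z * (\<Sum>i\<in>I. U i z * U i y))"
      using that fin by (simp add: orthonormal_complete[OF fin U] if_distrib cong: if_cong)
    also have "\<dots> = (\<Sum>i\<in>I. mv I A (U i) x * U i y)"
      unfolding mv_def sum_distrib_left sum_distrib_right
      by (subst sum.swap) (simp add: mult_ac)
    also have "\<dots> = (\<Sum>i\<in>I. a i * U i x * U i y)"
      using a that by (intro sum.cong) auto
    finally show ?thesis .
  qed
  then show thesis using that U fin by (auto simp: eigsys_def)
qed

section \<open>Matrix exponential and the Gibbs variational inequality\<close>

text \<open>The Hilbert-Schmidt pairing. It equals the trace of the product once one factor is
  symmetric, and stands for such traces throughout.\<close>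

definition mip :: "'i set \<Rightarrow> ('i \<Rightarrow> 'i \<Rightarrow> real) \<Rightarrow> ('i \<Rightarrow> 'i \<Rightarrow> real) \<Rightarrow> real" where
  "mip I A B = (\<Sum>x\<in>I. \<Sum>y\<in>I. A x y * B x y)"

definition idm :: "'i \<Rightarrow> 'i \<Rightarrow> real" where
  "idm x y = (if x = y then 1 else 0)"

lemma mip_commute: "mip I A B = mip I B A"
  by (simp add: mip_def mult.commute)

lemma mip_add_right: "mip I A (\<lambda>x y. B x y + C x y) = mip I A B + mip I A C"
  by (simp add: mip_def algebra_simps sum.distrib)

lemma mip_scale_right: "mip I A (\<lambda>x y. c * B x y) = c * mip I A B"
  by (simp add: mip_def sum_distrib_left mult_ac)

lemma mip_idm: "finite I \<Longrightarrow> mip I A idm = (\<Sum>x\<in>I. A x x)"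
  by (simp add: mip_def idm_def if_distrib cong: if_cong)

lemma bil_idm: "finite I \<Longrightarrow> bil I idm u v = ip I u v"
  by (simp add: bil_def ip_def idm_def if_distrib if_distribR cong: if_cong)

lemma eigsysD:
  assumes "eigsys I A U a"
  shows "finite I" "orthonormal_on I I U"
    and "\<And>x y. x \<in> I \<Longrightarrow> y \<in> I \<Longrightarrow> A x y = (\<Sum>i\<in>I. a i * U i x * U i y)"
  using assms by (auto simp: eigsys_def)

lemma eigsys_symmetric: "eigsys I A U a \<Longrightarrow> symmetric_on I A"
  unfolding symmetric_on_def by (auto simp: eigsysD(3) mult_ac)

section \<open>Traces and forms in eigenbases\<close>

lemma parseval:
  assumes "finite I" "orthonormal_on I I U"
  shows "(\<Sum>i\<in>I. ip I (U i) v * ip I (U i) w) = ip I v w"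
proof -
  have "(\<Sum>i\<in>I. ip I (U i) v * ip I (U i) w)
      = (\<Sum>i\<in>I. \<Sum>x\<in>I. \<Sum>y\<in>I. v x * w y * (U i x * U i y))"
    by (simp add: ip_def sum_product mult_ac)
  also have "\<dots> = (\<Sum>x\<in>I. \<Sum>i\<in>I. \<Sum>y\<in>I. v x * w y * (U i x * U i y))"
    by (rule sum.swap)
  also have "\<dots> = (\<Sum>x\<in>I. \<Sum>y\<in>I. v x * w y * (\<Sum>i\<in>I. U i x * U i y))"
    by (rule sum.cong[OF refl]) (subst sum.swap, simp add: sum_distrib_left)
  also have "\<dots> = ip I v w"
    using assms by (simp add: orthonormal_complete[OF assms] ip_def if_distrib cong: if_cong)
  finally show ?thesis .
qed

lemma parseval_unit:
  assumes "finite I" "orthonormal_on I I U" "orthonormal_on I I V" "j \<in> I"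
  shows "(\<Sum>i\<in>I. (ip I (U i) (V j))\<^sup>2) = 1" "(\<Sum>i\<in>I. (ip I (V j) (U i))\<^sup>2) = 1"
proof -
  have c: "ip I (V j) (U i) = ip I (U i) (V j)" for i by (rule ip_commute)
  show "(\<Sum>i\<in>I. (ip I (U i) (V j))\<^sup>2) = 1"
    using parseval[OF assms(1,2), of "V j" "V j"] assms(3,4)
    by (simp add: orthonormal_on_def power2_eq_square)
  then show "(\<Sum>i\<in>I. (ip I (V j) (U i))\<^sup>2) = 1" by (simp add: c)
qed

lemma mip_eigsys:
  assumes "eigsys I A U a"
  shows "mip I A B = (\<Sum>i\<in>I. a i * bil I B (U i) (U i))"
proof -
  have "mip I A B = (\<Sum>x\<in>I. \<Sum>y\<in>I. \<Sum>i\<in>I. a i * (B x y * U i x * U i y))"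
    by (auto simp: mip_def eigsysD(3)[OF assms] sum_distrib_left mult_ac intro!: sum.cong)
  also have "\<dots> = (\<Sum>x\<in>I. \<Sum>i\<in>I. \<Sum>y\<in>I. a i * (B x y * U i x * U i y))"
    by (intro sum.cong refl sum.swap)
  also have "\<dots> = (\<Sum>i\<in>I. \<Sum>x\<in>I. \<Sum>y\<in>I. a i * (B x y * U i x * U i y))"
    by (rule sum.swap)
  also have "\<dots> = (\<Sum>i\<in>I. a i * bil I B (U i) (U i))"
    by (simp add: bil_def sum_distrib_left)
  finally show ?thesis .
qed

lemma bil_eigsys:
  assumes "eigsys I A U a"
  shows "bil I A v w = (\<Sum>i\<in>I. a i * (ip I (U i) v * ip I (U i) w))"
proof -
  have "bil I A v w = mip I A (\<lambda>x y. v x * w y)"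
    by (simp add: bil_def mip_def mult_ac)
  also have "\<dots> = (\<Sum>i\<in>I. a i * bil I (\<lambda>x y. v x * w y) (U i) (U i))"
    by (rule mip_eigsys[OF assms])
  also have "\<dots> = (\<Sum>i\<in>I. a i * (ip I (U i) v * ip I (U i) w))"
    by (simp add: bil_def ip_def sum_product mult_ac)
  finally show ?thesis .
qed

lemma bil_eigvec:
  assumes "eigsys I A U a" "i \<in> I"
  shows "bil I A (U i) (U i) = a i"
proof -
  have "bil I A (U i) (U i) = (\<Sum>j\<in>I. if j = i then a j else 0)"
    unfolding bil_eigsys[OF assms(1)] using assms eigsysD(2)[OF assms(1)]
    by (intro sum.cong) (auto simp: orthonormal_on_def)
  then show ?thesis using assms eigsysD(1)[OF assms(1)] by simp
qed

lemma mip_eigsys2: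
  assumes "eigsys I A U a" "eigsys I B V b"
  shows "mip I A B = (\<Sum>i\<in>I. \<Sum>j\<in>I. (ip I (U i) (V j))\<^sup>2 * (a i * b j))"
proof -
  have c: "ip I (V j) (U i) = ip I (U i) (V j)" for i j by (rule ip_commute)
  show ?thesis
    unfolding mip_eigsys[OF assms(1)] bil_eigsys[OF assms(2)]
    by (simp add: sum_distrib_left power2_eq_square c mult_ac)
qed

lemma trace_eigsys:
  assumes "eigsys I A U a"
  shows "(\<Sum>x\<in>I. A x x) = (\<Sum>i\<in>I. a i)" "mip I A idm = (\<Sum>i\<in>I. a i)"
proof -
  show "mip I A idm = (\<Sum>i\<in>I. a i)"
    unfolding mip_eigsys[OF assms] using eigsysD(1,2)[OF assms]
    by (simp add: bil_idm orthonormal_on_def)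
  then show "(\<Sum>x\<in>I. A x x) = (\<Sum>i\<in>I. a i)"
    using eigsysD(1)[OF assms] by (simp add: mip_idm)
qed

text \<open>The squared overlaps of two orthonormal bases are doubly stochastic. This lifts
  inequalities between numbers \<open>a i\<close> and \<open>b j\<close> to trace inequalities for
  kernels that do not commute.\<close>

lemma sum_weights:
  assumes "eigsys I A U a" "eigsys I B V b"
  shows "(\<Sum>i\<in>I. \<Sum>j\<in>I. (ip I (U i) (V j))\<^sup>2 * f i) = (\<Sum>i\<in>I. f i)"
    and "(\<Sum>i\<in>I. \<Sum>j\<in>I. (ip I (U i) (V j))\<^sup>2 * f j) = (\<Sum>j\<in>I. f j)"
proof -
  show "(\<Sum>i\<in>I. \<Sum>j\<in>I. (ip I (U i) (V j))\<^sup>2 * f i) = (\<Sum>i\<in>I. f i)"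
    using parseval_unit(2)[OF eigsysD(1)[OF assms(1)] eigsysD(2)[OF assms(2)] eigsysD(2)[OF assms(1)]]
    by (simp add: sum_distrib_right[symmetric])
  show "(\<Sum>i\<in>I. \<Sum>j\<in>I. (ip I (U i) (V j))\<^sup>2 * f j) = (\<Sum>j\<in>I. f j)"
    using parseval_unit(1)[OF eigsysD(1)[OF assms(1)] eigsysD(2)[OF assms(1)] eigsysD(2)[OF assms(2)]]
    by (subst sum.swap) (simp add: sum_distrib_right[symmetric])
qed

section \<open>The exponential of a kernel and its trace\<close>

fun mpow :: "'i set \<Rightarrow> ('i \<Rightarrow> 'i \<Rightarrow> real) \<Rightarrow> nat \<Rightarrow> 'i \<Rightarrow> 'i \<Rightarrow> real" where
  "mpow I A 0 x y = idm x y"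
| "mpow I A (Suc n) x y = (\<Sum>z\<in>I. A x z * mpow I A n z y)"

text \<open>A power series in the entries, and not a formula in a chosen eigenbasis, so that
  measurability in a random kernel is immediate. \<open>mexp_eigsys\<close> recovers the spectral
  form.\<close>

definition mexp :: "'i set \<Rightarrow> ('i \<Rightarrow> 'i \<Rightarrow> real) \<Rightarrow> 'i \<Rightarrow> 'i \<Rightarrow> real" where
  "mexp I A x y = (\<Sum>n. mpow I A n x y / fact n)"

definition trexp :: "'i set \<Rightarrow> ('i \<Rightarrow> 'i \<Rightarrow> real) \<Rightarrow> real" where
  "trexp I A = (\<Sum>x\<in>I. mexp I A x x)"

lemma eigsys_mult:
  assumes "eigsys I A U a" "x \<in> I" "y \<in> I"
  shows "(\<Sum>z\<in>I. A x z * (\<Sum>i\<in>I. b i * U i z * U i y)) = (\<Sum>i\<in>I. a i * b i * U i x * U i y)"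
proof -
  have eigvec: "(\<Sum>z\<in>I. A x z * U i z) = a i * U i x" if "i \<in> I" for i
  proof -
    have "(\<Sum>z\<in>I. A x z * U i z) = (\<Sum>z\<in>I. \<Sum>j\<in>I. a j * U j x * (U j z * U i z))"
      using assms(2) by (intro sum.cong) (auto simp: eigsysD(3)[OF assms(1)] sum_distrib_right sum_distrib_left mult_ac)
    also have "\<dots> = (\<Sum>j\<in>I. a j * U j x * ip I (U j) (U i))"
      by (subst sum.swap) (simp add: ip_def sum_distrib_left)
    also have "\<dots> = (\<Sum>j\<in>I. if j = i then a j * U j x else 0)"
      using that eigsysD(2)[OF assms(1)] by (intro sum.cong) (auto simp: orthonormal_on_def)
    finally show ?thesis using that eigsysD(1)[OF assms(1)] by simp
  qed
  have "(\<Sum>z\<in>I. A x z * (\<Sum>i\<in>I. b i * U i z * U i y))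
      = (\<Sum>z\<in>I. \<Sum>i\<in>I. (A x z * U i z) * (b i * U i y))"
    by (simp add: sum_distrib_left mult_ac)
  also have "\<dots> = (\<Sum>i\<in>I. (\<Sum>z\<in>I. A x z * U i z) * (b i * U i y))"
    by (subst sum.swap) (simp add: sum_distrib_right)
  also have "\<dots> = (\<Sum>i\<in>I. a i * b i * U i x * U i y)"
    by (intro sum.cong refl) (simp add: eigvec mult_ac)
  finally show ?thesis .
qed

lemma mpow_eigsys:
  assumes "eigsys I A U a" "x \<in> I" "y \<in> I"
  shows "mpow I A n x y = (\<Sum>i\<in>I. a i ^ n * U i x * U i y)"
  using assms(2,3)
proof (induction n arbitrary: x y)
  case 0
  then show ?case
    using orthonormal_complete[OF eigsysD(1,2)[OF assms(1)]] by (simp add: idm_def)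
next
  case (Suc n)
  have "mpow I A (Suc n) x y = (\<Sum>z\<in>I. A x z * (\<Sum>i\<in>I. a i ^ n * U i z * U i y))"
    using Suc by simp
  then show ?case using eigsys_mult[OF assms(1) Suc.prems] by simp
qed

lemma mexp_eigsys:
  assumes "eigsys I A U a"
  shows "eigsys I (mexp I A) U (\<lambda>i. exp (a i))"
proof -
  have "mexp I A x y = (\<Sum>i\<in>I. exp (a i) * U i x * U i y)" if "x \<in> I" "y \<in> I" for x y
  proof -
    have "(\<lambda>n. a i ^ n / fact n * (U i x * U i y)) sums (exp (a i) * (U i x * U i y))" for i
      using exp_converges[of "a i"] by (intro sums_mult2) (simp add: divide_inverse mult.commute)
    then have "(\<lambda>n. \<Sum>i\<in>I. a i ^ n / fact n * (U i x * U i y)) sums (\<Sum>i\<in>I. exp (a i) * (U i x * U i y))"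
      by (intro sums_sum)
    moreover have "(\<lambda>n. \<Sum>i\<in>I. a i ^ n / fact n * (U i x * U i y)) = (\<lambda>n. mpow I A n x y / fact n)"
      using that by (simp add: mpow_eigsys[OF assms] sum_divide_distrib mult_ac)
    ultimately show ?thesis by (simp add: mexp_def sums_iff mult.assoc)
  qed
  then show ?thesis using assms by (simp add: eigsys_def)
qed

lemma trexp_eigsys: "eigsys I A U a \<Longrightarrow> trexp I A = (\<Sum>i\<in>I. exp (a i))"
  unfolding trexp_def by (rule trace_eigsys(1)[OF mexp_eigsys])

text \<open>Klein's inequality in the Gibbs variational form, with the weights \<open>\<langle>u\<^sub>i,v\<^sub>j\<rangle>\<^sup>2\<close>
  reducing it to \<open>t (1 + b - ln t) \<le> exp b\<close>.\<close>
lemma gibbs_variational: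
  assumes T: "eigsys I T U t" and pos: "\<And>i. i \<in> I \<Longrightarrow> 0 < t i" and B: "symmetric_on I B"
  shows "mip I T B + (\<Sum>i\<in>I. t i) - (\<Sum>i\<in>I. t i * ln (t i)) \<le> trexp I B"
proof -
  obtain V b where V: "eigsys I B V b"
    using spectral_theorem[OF eigsysD(1)[OF T] B] by blast
  have scalar: "s * c + s - s * ln s \<le> exp c" if "0 < s" for s c :: real
  proof -
    have "1 + (c - ln s) \<le> exp (c - ln s)" by (rule exp_ge_add_one_self)
    then have "s * (1 + (c - ln s)) \<le> s * exp (c - ln s)" using that by simp
    also have "s * exp (c - ln s) = exp c" using that by (simp add: exp_diff)
    finally show ?thesis by (simp add: algebra_simps)
  qed
  have "mip I T B + (\<Sum>i\<in>I. t i) - (\<Sum>i\<in>I. t i * ln (t i))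
     = (\<Sum>i\<in>I. \<Sum>j\<in>I. (ip I (U i) (V j))\<^sup>2 * (t i * b j))
      + (\<Sum>i\<in>I. \<Sum>j\<in>I. (ip I (U i) (V j))\<^sup>2 * (t i - t i * ln (t i)))"
    unfolding sum_weights(1)[OF T V] mip_eigsys2[OF T V] by (simp add: sum_subtractf)
  also have "\<dots> = (\<Sum>i\<in>I. \<Sum>j\<in>I. (ip I (U i) (V j))\<^sup>2 * (t i * b j + t i - t i * ln (t i)))"
    by (simp add: sum.distrib[symmetric] algebra_simps)
  also have "\<dots> \<le> (\<Sum>i\<in>I. \<Sum>j\<in>I. (ip I (U i) (V j))\<^sup>2 * exp (b j))"
    by (intro sum_mono mult_left_mono scalar pos) auto
  also have "\<dots> = trexp I B"
    unfolding sum_weights(2)[OF T V] by (simp add: trexp_eigsys[OF V])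
  finally show ?thesis .
qed

text \<open>The choice \<open>T = exp A\<close> gives equality in the Gibbs inequality for
  \<open>A\<close>. Pairing with this positive kernel is monotone, so the same \<open>T\<close>
  bounds \<open>trexp I B\<close> from below.\<close>

lemma trexp_mono:
  assumes "finite I" "symmetric_on I A" "symmetric_on I B"
    and le: "\<And>v. bil I A v v \<le> bil I B v v"
  shows "trexp I A \<le> trexp I B"
proof -
  obtain U a where U: "eigsys I A U a"
    using spectral_theorem assms(1,2) by blast
  have "trexp I A = (\<Sum>i\<in>I. exp (a i) * a i) + (\<Sum>i\<in>I. exp (a i)) - (\<Sum>i\<in>I. exp (a i) * ln (exp (a i)))"
    by (simp add: trexp_eigsys[OF U])
  also have "(\<Sum>i\<in>I. exp (a i) * a i) \<le> mip I (mexp I A) B"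
    unfolding mip_eigsys[OF mexp_eigsys[OF U]] using bil_eigvec[OF U] le
    by (intro sum_mono mult_left_mono) (metis, simp)
  also have "mip I (mexp I A) B + (\<Sum>i\<in>I. exp (a i)) - (\<Sum>i\<in>I. exp (a i) * ln (exp (a i))) \<le> trexp I B"
    by (rule gibbs_variational[OF mexp_eigsys[OF U] _ assms(3)]) simp
  finally show ?thesis by simp
qed

section \<open>A supporting hyperplane for the relative entropy\<close>

text \<open>For numbers, \<open>c^2 t (t - a) / ((1 - u) t + u a)\<close> is the maximum over
  \<open>y\<close> of \<open>(t - a) c^2 + 2 u (t - a) c y - u ((1 - u) t + u a) y^2\<close>. In
  this expression \<open>t\<close> has the coefficient \<open>c^2 + 2 u c y - u (1 - u) y^2\<close>
  and \<open>- a\<close> has \<open>(c + u y)^2\<close>. \<open>tangent_P\<close> and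
  \<open>tangent_R\<close> are these two coefficients with a kernel \<open>Y\<close> in place of
  \<open>y\<close>; the second is a Gram kernel, hence positive semidefinite.\<close>

definition tangent_P :: "'i set \<Rightarrow> ('i \<Rightarrow> 'i \<Rightarrow> real) \<Rightarrow> real \<Rightarrow> 'i \<Rightarrow> 'i \<Rightarrow> real" where
  "tangent_P I Y u x z = idm x z + 2 * u * Y x z - u * (1 - u) * (\<Sum>w\<in>I. Y x w * Y z w)"

definition tangent_R :: "'i set \<Rightarrow> ('i \<Rightarrow> 'i \<Rightarrow> real) \<Rightarrow> real \<Rightarrow> 'i \<Rightarrow> 'i \<Rightarrow> real" where
  "tangent_R I Y u x z = (\<Sum>w\<in>I. (idm w x + u * Y w x) * (idm w z + u * Y w z))"

lemma sum_square_kernel: "bil I (\<lambda>x z. \<Sum>w\<in>I. Y w x * Y w z) v v = ip I (mv I Y v) (mv I Y v)"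
proof -
  have "bil I (\<lambda>x z. \<Sum>w\<in>I. Y w x * Y w z) v v
      = (\<Sum>x\<in>I. \<Sum>z\<in>I. \<Sum>w\<in>I. Y w x * v x * (Y w z * v z))"
    by (simp add: bil_def sum_distrib_left sum_distrib_right mult_ac)
  also have "\<dots> = (\<Sum>x\<in>I. \<Sum>w\<in>I. \<Sum>z\<in>I. Y w x * v x * (Y w z * v z))"
    by (rule sum.cong[OF refl], rule sum.swap)
  also have "\<dots> = (\<Sum>w\<in>I. \<Sum>x\<in>I. \<Sum>z\<in>I. Y w x * v x * (Y w z * v z))"
    by (rule sum.swap)
  also have "\<dots> = ip I (mv I Y v) (mv I Y v)"
    by (simp add: ip_def mv_def sum_product)
  finally show ?thesis .
qed

lemma bil_tangent_R:
  assumes "finite I"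
  shows "bil I (tangent_R I Y u) v v
    = ip I v v + 2 * u * bil I Y v v + u\<^sup>2 * ip I (mv I Y v) (mv I Y v)"
proof -
  have mv: "mv I (\<lambda>w x. idm w x + u * Y w x) v w = v w + u * mv I Y v w" if "w \<in> I" for w
  proof -
    have "(\<Sum>x\<in>I. idm w x * v x) = v w"
      using that assms by (simp add: idm_def if_distrib if_distribR cong: if_cong)
    then show ?thesis
      by (simp add: mv_def distrib_right sum.distrib sum_distrib_left mult.assoc)
  qed
  have "bil I (tangent_R I Y u) v v
      = ip I (mv I (\<lambda>w x. idm w x + u * Y w x) v) (mv I (\<lambda>w x. idm w x + u * Y w x) v)"
    unfolding tangent_R_def by (rule sum_square_kernel)
  also have "\<dots> = ip I (\<lambda>w. v w + u * mv I Y v w) (\<lambda>w. v w + u * mv I Y v w)"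
    by (intro ip_cong mv)
  also have "\<dots> = ip I v v + 2 * u * ip I v (mv I Y v) + u\<^sup>2 * ip I (mv I Y v) (mv I Y v)"
    by (simp add: ip_def algebra_simps sum.distrib sum_distrib_left power2_eq_square)
  finally show ?thesis by (simp add: bil_eq_ip)
qed

lemma bil_tangent_P:
  assumes "finite I"
  shows "bil I (tangent_P I Y u) v v
    = ip I v v + 2 * u * bil I Y v v - u * (1 - u) * ip I (mv I (\<lambda>x y. Y y x) v) (mv I (\<lambda>x y. Y y x) v)"
proof -
  have "bil I (tangent_P I Y u) v v = bil I idm v v + 2 * u * bil I Y v v
      - u * (1 - u) * bil I (\<lambda>x z. \<Sum>w\<in>I. Y x w * Y z w) v v"
    by (simp add: bil_def tangent_P_def algebra_simps sum.distrib sum_subtractf sum_distrib_left)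
  then show ?thesis
    using sum_square_kernel[of I "\<lambda>x y. Y y x" v] assms by (simp add: bil_idm)
qed

text \<open>The form of \<open>tangent_P\<close> at \<open>U i\<close> is expanded in the basis
  \<open>V\<close>, that of \<open>tangent_R\<close> at \<open>V j\<close> in the basis
  \<open>U\<close>. Both become sums over the same pairs \<open>(i, j)\<close>, and the functional
  splits into separate scalar quadratics in the numbers \<open>bil I Y (U i) (V j)\<close>.\<close>

lemma tangent_functional:
  assumes T: "eigsys I T U t" and A: "eigsys I A V a"
  shows "mip I T (tangent_P I Y u) - mip I A (tangent_R I Y u)
    = (\<Sum>i\<in>I. \<Sum>j\<in>I. (t i - a j) * (ip I (U i) (V j))\<^sup>2
        + 2 * u * (t i - a j) * ip I (U i) (V j) * bil I Y (U i) (V j)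
        - u * ((1 - u) * t i + u * a j) * (bil I Y (U i) (V j))\<^sup>2)"
proof -
  define c where "c i j = ip I (U i) (V j)" for i j
  define y where "y i j = bil I Y (U i) (V j)" for i j
  note fin = eigsysD(1)[OF T]
  have cT: "ip I (V j) (U i) = c i j" for i j by (simp add: c_def ip_commute)
  have yT: "bil I (\<lambda>x y. Y y x) (V j) (U i) = y i j" for i j
    unfolding y_def bil_def by (subst sum.swap) (simp add: mult_ac)
  \<comment> \<open>\<open>Y\<close> need not be symmetric, and expanding in the basis
    \<open>V\<close> requires its transpose to act on \<open>U i\<close>.\<close>
  have YT: "bil I Y v v = bil I (\<lambda>x y. Y y x) v v" for v
    unfolding bil_def by (subst sum.swap) (simp add: mult_ac)
  have P: "bil I (tangent_P I Y u) (U i) (U i)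
      = (\<Sum>j\<in>I. (c i j)\<^sup>2 + 2 * u * c i j * y i j - u * (1 - u) * (y i j)\<^sup>2)" if "i \<in> I" for i
  proof -
    let ?w = "mv I (\<lambda>x y. Y y x) (U i)"
    have "ip I (U i) (U i) = (\<Sum>j\<in>I. (c i j)\<^sup>2)"
      unfolding parseval[OF fin eigsysD(2)[OF A], of "U i" "U i", symmetric]
      by (simp add: cT power2_eq_square)
    moreover have "bil I Y (U i) (U i) = (\<Sum>j\<in>I. c i j * y i j)"
      unfolding YT unfolding bil_eq_ip parseval[OF fin eigsysD(2)[OF A], of "U i" ?w, symmetric]
      by (simp add: cT bil_eq_ip[symmetric] yT)
    moreover have "ip I ?w ?w = (\<Sum>j\<in>I. (y i j)\<^sup>2)"
      unfolding parseval[OF fin eigsysD(2)[OF A], of ?w ?w, symmetric]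
      by (simp add: bil_eq_ip[symmetric] yT power2_eq_square)
    ultimately show ?thesis
      by (simp add: bil_tangent_P[OF fin] sum.distrib sum_subtractf sum_distrib_left mult_ac)
  qed
  have R: "bil I (tangent_R I Y u) (V j) (V j)
      = (\<Sum>i\<in>I. (c i j)\<^sup>2 + 2 * u * c i j * y i j + u\<^sup>2 * (y i j)\<^sup>2)" if "j \<in> I" for j
  proof -
    let ?w = "mv I Y (V j)"
    have "ip I (V j) (V j) = (\<Sum>i\<in>I. (c i j)\<^sup>2)"
      unfolding parseval[OF fin eigsysD(2)[OF T], of "V j" "V j", symmetric]
      by (simp add: c_def power2_eq_square)
    moreover have "bil I Y (V j) (V j) = (\<Sum>i\<in>I. c i j * y i j)"
      unfolding bil_eq_ip parseval[OF fin eigsysD(2)[OF T], of "V j" ?w, symmetric]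
      by (simp add: c_def bil_eq_ip[symmetric] y_def)
    moreover have "ip I ?w ?w = (\<Sum>i\<in>I. (y i j)\<^sup>2)"
      unfolding parseval[OF fin eigsysD(2)[OF T], of ?w ?w, symmetric]
      by (simp add: bil_eq_ip[symmetric] y_def power2_eq_square)
    ultimately show ?thesis
      by (simp add: bil_tangent_R[OF fin] sum.distrib sum_distrib_left mult_ac)
  qed
  have "mip I T (tangent_P I Y u) = (\<Sum>i\<in>I. \<Sum>j\<in>I. t i * ((c i j)\<^sup>2 + 2 * u * c i j * y i j - u * (1 - u) * (y i j)\<^sup>2))"
    by (simp add: mip_eigsys[OF T] P sum_distrib_left)
  moreover have "mip I A (tangent_R I Y u) = (\<Sum>i\<in>I. \<Sum>j\<in>I. a j * ((c i j)\<^sup>2 + 2 * u * c i j * y i j + u\<^sup>2 * (y i j)\<^sup>2))"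
    by (subst sum.swap) (simp add: mip_eigsys[OF A] R sum_distrib_left)
  ultimately show ?thesis
    unfolding c_def[symmetric] y_def[symmetric]
    by (simp add: sum_subtractf[symmetric]) (simp add: algebra_simps power2_eq_square)
qed

text \<open>Completing the square: the two sides differ by \<open>u D (y - c (t - a) / D)^2\<close>,
  which also identifies the maximizer.\<close>

lemma tangent_scalar:
  fixes t a u c y :: real
  assumes "0 < t" "0 < a" "0 \<le> u" "u \<le> 1"
  defines "D \<equiv> (1 - u) * t + u * a"
  shows "(t - a) * c\<^sup>2 + 2 * u * (t - a) * c * y - u * D * y\<^sup>2 \<le> c\<^sup>2 * (t * (t - a) / D)"
    and "y = c * ((t - a) / D) \<Longrightarrow>
      (t - a) * c\<^sup>2 + 2 * u * (t - a) * c * y - u * D * y\<^sup>2 = c\<^sup>2 * (t * (t - a) / D)"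
proof -
  have D: "0 < D"
  proof (cases "u = 0")
    case False
    then have "0 < u * a" "0 \<le> (1 - u) * t" using assms by auto
    then show ?thesis by (simp add: D_def)
  qed (use assms in \<open>simp add: D_def\<close>)
  have t: "t = D + u * (t - a)" by (simp add: D_def algebra_simps)
  have "c\<^sup>2 * (t * (t - a) / D) = c\<^sup>2 * ((D + u * (t - a)) * (t - a) / D)"
    using t by simp
  also have "\<dots> = (t - a) * c\<^sup>2 + u * (c * (t - a))\<^sup>2 / D"
    using D by (simp add: field_simps power2_eq_square)
  also have "\<dots> - ((t - a) * c\<^sup>2 + 2 * u * (t - a) * c * y - u * D * y\<^sup>2)
      = u * D * (y - c * ((t - a) / D))\<^sup>2"
    using D by (simp add: field_simps power2_eq_square)
  finally have eq: "c\<^sup>2 * (t * (t - a) / D) - ((t - a) * c\<^sup>2 + 2 * u * (t - a) * c * y - u * D * y\<^sup>2)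
      = u * D * (y - c * ((t - a) / D))\<^sup>2" .
  then show "(t - a) * c\<^sup>2 + 2 * u * (t - a) * c * y - u * D * y\<^sup>2 \<le> c\<^sup>2 * (t * (t - a) / D)"
    using D \<open>0 \<le> u\<close> by (metis diff_ge_0_iff_ge mult_nonneg_nonneg less_imp_le zero_le_power2)
  show "(t - a) * c\<^sup>2 + 2 * u * (t - a) * c * y - u * D * y\<^sup>2 = c\<^sup>2 * (t * (t - a) / D)"
    if "y = c * ((t - a) / D)" using eq that by simp
qed

lemma integral_entropy_scalar:
  fixes t a :: real
  assumes "0 < t" "0 < a"
  shows "((\<lambda>u. t * (t - a) / ((1 - u) * t + u * a)) has_integral t * (ln t - ln a)) {0..1}"
proof -
  have D: "0 < (1 - u) * t + u * a" if "0 \<le> u" "u \<le> 1" for u :: real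
  proof (cases "u = 0")
    case False
    then have "0 < u * a" "0 \<le> (1 - u) * t" using assms that by auto
    then show ?thesis by simp
  qed (use assms in simp)
  have "((\<lambda>u. t * (t - a) / ((1 - u) * t + u * a)) has_integral
      (- t * ln ((1 - 1) * t + 1 * a)) - (- t * ln ((1 - 0) * t + 0 * a))) {0..1}"
  proof (rule fundamental_theorem_of_calculus)
    fix u :: real assume "u \<in> {0..1}"
    then have "0 < (1 - u) * t + u * a" using D by auto
    then have "((\<lambda>u. - t * ln ((1 - u) * t + u * a)) has_real_derivative
        t * (t - a) / ((1 - u) * t + u * a)) (at u within {0..1})"
      by (auto intro!: derivative_eq_intros simp: field_simps)
    then show "((\<lambda>u. - t * ln ((1 - u) * t + u * a)) has_vector_derivative
        t * (t - a) / ((1 - u) * t + u * a)) (at u within {0..1})"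
      by (simp add: has_real_derivative_iff_has_vector_derivative)
  qed simp
  then show ?thesis by (simp add: algebra_simps)
qed

lemma mip_has_integral:
  assumes "finite I" "\<And>x y. x \<in> I \<Longrightarrow> y \<in> I \<Longrightarrow> (\<lambda>u::real. P u x y) integrable_on S"
  shows "((\<lambda>u. mip I T (P u)) has_integral mip I T (\<lambda>x y. integral S (\<lambda>u. P u x y))) S"
  unfolding mip_def
  by (intro has_integral_sum has_integral_mult_right assms integrable_integral)

text \<open>The double sum is \<open>tr (T (ln T - ln A))\<close> expressed through eigenbases, so
  no logarithm of a kernel has to be defined. The minorant has no constant term because relative
  entropy is homogeneous of degree one.\<close>

definition entropy_minorant :: "'i set \<Rightarrow> ('i \<Rightarrow> 'i \<Rightarrow> real) \<Rightarrow> ('i \<Rightarrow> 'i \<Rightarrow> real) \<Rightarrow> bool" where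
  "entropy_minorant I P R \<longleftrightarrow> (\<forall>T U t A V a.
     eigsys I T U t \<longrightarrow> (\<forall>i\<in>I. 0 < t i) \<longrightarrow> eigsys I A V a \<longrightarrow> (\<forall>i\<in>I. 0 < a i) \<longrightarrow>
     mip I T P - mip I A R \<le> (\<Sum>i\<in>I. \<Sum>j\<in>I. (ip I (U i) (V j))\<^sup>2 * (t i * (ln (t i) - ln (a j)))))"

text \<open>Joint convexity of the relative entropy \<open>tr (T (ln T - ln A))\<close> in the form of a supporting
  hyperplane at \<open>(T0, A0)\<close>.  It comes from \<open>ln t - ln a = \<integral>\<^sub>0\<^sup>1 (t - a) / ((1 - u) t + u a) du\<close>: each
  integrand is a supremum over kernels \<open>Y\<close> of functionals linear in \<open>(T, A)\<close>.\<close>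
theorem relative_entropy_tangent:
  assumes T0: "eigsys I T0 U0 t0" and t0: "\<And>i. i \<in> I \<Longrightarrow> 0 < t0 i"
    and A0: "eigsys I A0 V0 a0" and a0: "\<And>i. i \<in> I \<Longrightarrow> 0 < a0 i"
  obtains P R where "\<And>v. 0 \<le> bil I R v v"
    "entropy_minorant I P R"
    "mip I T0 P - mip I A0 R = (\<Sum>i\<in>I. \<Sum>j\<in>I. (ip I (U0 i) (V0 j))\<^sup>2 * (t0 i * (ln (t0 i) - ln (a0 j))))"
proof -
  note fin = eigsysD(1)[OF T0]
  \<comment> \<open>The maximizer of \<open>tangent_scalar\<close> for each pair of eigenvalues of
    the base point; \<open>Y u\<close> is the kernel with these coefficients in the bases
    \<open>U0\<close> and \<open>V0\<close>.\<close>
  define y where "y u i j = ip I (U0 i) (V0 j) * ((t0 i - a0 j) / ((1 - u) * t0 i + u * a0 j))" for u i j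
  define Y where "Y u x z = (\<Sum>i\<in>I. \<Sum>j\<in>I. y u i j * U0 i x * V0 j z)" for u x z
  define P where "P = (\<lambda>x z. integral {0..1} (\<lambda>u. tangent_P I (Y u) u x z))"
  define R where "R = (\<lambda>x z. integral {0..1} (\<lambda>u. tangent_R I (Y u) u x z))"
  have D: "(1 - u) * t0 i + u * a0 j \<noteq> 0" if "u \<in> {0..1}" "i \<in> I" "j \<in> I" for u i j
  proof (cases "u = 0")
    case False
    then have "0 < u * a0 j" "0 \<le> (1 - u) * t0 i" using a0 t0 that by (auto simp: less_imp_le)
    then show ?thesis by simp
  qed (use t0 that in force)
  have contY: "continuous_on {0..1} (\<lambda>u. Y u x z)" for x z
    unfolding Y_def y_def by (intro continuous_intros) (use D in auto)
  have intP: "(\<lambda>u. tangent_P I (Y u) u x z) integrable_on {0..1}" for x z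
    unfolding tangent_P_def by (intro integrable_continuous_real continuous_intros contY)
  have intR: "(\<lambda>u. tangent_R I (Y u) u x z) integrable_on {0..1}" for x z
    unfolding tangent_R_def by (intro integrable_continuous_real continuous_intros contY)
  have lin: "((\<lambda>u. mip I T (tangent_P I (Y u) u) - mip I A (tangent_R I (Y u) u))
      has_integral (mip I T P - mip I A R)) {0..1}" for T A
    unfolding P_def R_def by (intro has_integral_diff mip_has_integral fin intP intR)
  have ent: "((\<lambda>u. \<Sum>i\<in>I. \<Sum>j\<in>I. (ip I (U i) (V j))\<^sup>2 * (t i * (t i - a j) / ((1 - u) * t i + u * a j)))
      has_integral (\<Sum>i\<in>I. \<Sum>j\<in>I. (ip I (U i) (V j))\<^sup>2 * (t i * (ln (t i) - ln (a j))))) {0..1}"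
    if "\<And>i. i \<in> I \<Longrightarrow> 0 < t i" "\<And>i. i \<in> I \<Longrightarrow> 0 < a i" for U V t a
    using that by (intro has_integral_sum has_integral_mult_right integral_entropy_scalar fin) auto
  show thesis
  proof (rule that)
    fix v
    \<comment> \<open>Read as a pairing with a rank-one kernel, the form commutes with the integral
      over \<open>u\<close>, and each integrand is the form of a Gram kernel.\<close>
    have "bil I R v v = mip I (\<lambda>x z. v x * v z) R"
      by (simp add: bil_def mip_def mult_ac)
    moreover have int: "((\<lambda>u. mip I (\<lambda>x z. v x * v z) (tangent_R I (Y u) u))
        has_integral mip I (\<lambda>x z. v x * v z) R) {0..1}"
      unfolding R_def by (intro mip_has_integral fin intR)
    moreover have nonneg: "0 \<le> mip I (\<lambda>x z. v x * v z) (tangent_R I (Y u) u)" for u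
    proof -
      have "mip I (\<lambda>x z. v x * v z) (tangent_R I (Y u) u) = bil I (tangent_R I (Y u) u) v v"
        by (simp add: bil_def mip_def mult_ac)
      then show ?thesis
        unfolding tangent_R_def
        using sum_square_kernel[of I "\<lambda>w x. idm w x + u * Y u w x" v] by (simp add: ip_self_nonneg)
    qed
    ultimately show "0 \<le> bil I R v v" using has_integral_nonneg[OF int nonneg] by simp
  next
    have "mip I T P - mip I A R \<le> (\<Sum>i\<in>I. \<Sum>j\<in>I. (ip I (U i) (V j))\<^sup>2 * (t i * (ln (t i) - ln (a j))))"
      if T: "eigsys I T U t" and t: "\<And>i. i \<in> I \<Longrightarrow> 0 < t i"
        and A: "eigsys I A V a" and a: "\<And>i. i \<in> I \<Longrightarrow> 0 < a i" for T U t A V a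
    proof (rule has_integral_le[OF lin ent[OF t a]])
      fix u :: real assume "u \<in> {0..1}"
      then show "mip I T (tangent_P I (Y u) u) - mip I A (tangent_R I (Y u) u)
          \<le> (\<Sum>i\<in>I. \<Sum>j\<in>I. (ip I (U i) (V j))\<^sup>2 * (t i * (t i - a j) / ((1 - u) * t i + u * a j)))"
        unfolding tangent_functional[OF T A]
        by (intro sum_mono tangent_scalar(1) t a) auto
    qed
    then show "entropy_minorant I P R" unfolding entropy_minorant_def by blast
  next
    have bilY: "bil I (Y u) (U0 i) (V0 j) = y u i j" if "i \<in> I" "j \<in> I" for u i j
    proof -
      have "bil I (Y u) (U0 i) (V0 j)
          = (\<Sum>x\<in>I. \<Sum>z\<in>I. \<Sum>k\<in>I. \<Sum>l\<in>I. y u k l * (U0 k x * U0 i x) * (V0 l z * V0 j z))"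
        by (simp add: bil_def Y_def sum_distrib_left sum_distrib_right mult_ac)
      also have "\<dots> = (\<Sum>x\<in>I. \<Sum>k\<in>I. \<Sum>z\<in>I. \<Sum>l\<in>I. y u k l * (U0 k x * U0 i x) * (V0 l z * V0 j z))"
        by (rule sum.cong[OF refl], rule sum.swap)
      also have "\<dots> = (\<Sum>k\<in>I. \<Sum>x\<in>I. \<Sum>l\<in>I. \<Sum>z\<in>I. y u k l * (U0 k x * U0 i x) * (V0 l z * V0 j z))"
        by (subst sum.swap, rule sum.cong[OF refl], rule sum.cong[OF refl], rule sum.swap)
      also have "\<dots> = (\<Sum>k\<in>I. \<Sum>l\<in>I. \<Sum>x\<in>I. \<Sum>z\<in>I. y u k l * (U0 k x * U0 i x) * (V0 l z * V0 j z))"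
        by (rule sum.cong[OF refl], rule sum.swap)
      also have "\<dots> = (\<Sum>k\<in>I. \<Sum>l\<in>I. y u k l * ip I (U0 k) (U0 i) * ip I (V0 l) (V0 j))"
        by (simp add: ip_def sum_product sum_distrib_left mult_ac)
      also have "\<dots> = (\<Sum>k\<in>I. \<Sum>l\<in>I. if k = i then if l = j then y u i j else 0 else 0)"
        using that eigsysD(2)[OF T0] eigsysD(2)[OF A0]
        by (intro sum.cong refl) (auto simp: orthonormal_on_def)
      also have "\<dots> = (\<Sum>k\<in>I. if k = i then y u i j else 0)"
        using that fin by (intro sum.cong refl) auto
      finally show ?thesis using that fin by simp
    qed
    \<comment> \<open>At the base point every scalar quadratic sits at its maximum, so equality
      holds for each \<open>u\<close> and survives integration.\<close>
    have "mip I T0 (tangent_P I (Y u) u) - mip I A0 (tangent_R I (Y u) u)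
          = (\<Sum>i\<in>I. \<Sum>j\<in>I. (ip I (U0 i) (V0 j))\<^sup>2 * (t0 i * (t0 i - a0 j) / ((1 - u) * t0 i + u * a0 j)))"
      if "u \<in> {0..1}" for u
      unfolding tangent_functional[OF T0 A0]
      using that by (intro sum.cong refl tangent_scalar(2) t0 a0) (auto simp: bilY y_def)
    from has_integral_eq[OF this lin[of T0 A0]]
    have "((\<lambda>u. \<Sum>i\<in>I. \<Sum>j\<in>I. (ip I (U0 i) (V0 j))\<^sup>2 * (t0 i * (t0 i - a0 j) / ((1 - u) * t0 i + u * a0 j)))
        has_integral (mip I T0 P - mip I A0 R)) {0..1}"
      by simp
    then show "mip I T0 P - mip I A0 R = (\<Sum>i\<in>I. \<Sum>j\<in>I. (ip I (U0 i) (V0 j))\<^sup>2 * (t0 i * (ln (t0 i) - ln (a0 j))))"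
      by (rule has_integral_unique[OF _ ent[OF t0 a0]])
  qed
qed

section \<open>One random summand\<close>

text \<open>From the quadratic term on, the series is dominated by a geometric one with ratio
  \<open>q = \<theta> L / 3\<close>, because \<open>(n + 2)!\<close> is at least
  \<open>2 * 3 ^ n\<close>. This is the origin of \<open>L / 3\<close> in the final bound.\<close>

lemma exp_le_bernstein:
  fixes \<theta> L x :: real
  assumes "0 \<le> \<theta>" "\<theta> * L < 3" "\<bar>x\<bar> \<le> L"
  shows "exp (\<theta> * x) \<le> 1 + \<theta> * x + \<theta>\<^sup>2 / 2 / (1 - \<theta> * L / 3) * x\<^sup>2"
proof -
  define y where "y = \<theta> * x"
  define q where "q = \<theta> * L / 3"
  have q: "0 \<le> q" "q < 1" using assms by (auto simp: q_def)
  have y: "\<bar>y\<bar> \<le> 3 * q"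
    using assms mult_left_mono[OF assms(3,1)] by (simp add: y_def q_def abs_mult)
  have fact3: "2 * 3 ^ n \<le> (fact (n + 2) :: real)" for n
  proof (induction n)
    case (Suc n)
    have "2 * 3 ^ Suc n = 3 * (2 * 3 ^ n :: real)" by simp
    also have "\<dots> \<le> real (n + 3) * fact (n + 2)"
      using Suc by (intro mult_mono) auto
    finally show ?case by (simp add: algebra_simps)
  qed simp
  have "exp y = 1 + y + (\<Sum>n. inverse (fact (n + 2)) * y ^ (n + 2))"
    by (rule exp_first_two_terms[of y, unfolded real_scaleR_def])
  also have "(\<Sum>n. inverse (fact (n + 2)) * y ^ (n + 2)) \<le> (\<Sum>n. y\<^sup>2 / 2 * q ^ n)"
  proof (rule suminf_le)
    show "inverse (fact (n + 2)) * y ^ (n + 2) \<le> y\<^sup>2 / 2 * q ^ n" for n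
    proof -
      have "inverse (fact (n + 2)) * y ^ (n + 2) \<le> \<bar>inverse (fact (n + 2)) * y ^ (n + 2)\<bar>" by simp
      also have "\<dots> = y\<^sup>2 * \<bar>y\<bar> ^ n / fact (n + 2)"
        by (simp add: abs_mult power_add power_abs divide_inverse power2_eq_square)
      also have "\<dots> \<le> y\<^sup>2 * (3 * q) ^ n / (2 * 3 ^ n)"
        using y fact3[of n] by (intro frac_le mult_left_mono power_mono) auto
      also have "\<dots> = y\<^sup>2 / 2 * q ^ n"
        by (simp add: power_mult_distrib)
      finally show ?thesis .
    qed
    show "summable (\<lambda>n. inverse (fact (n + 2)) * y ^ (n + 2))"
      using summable_exp[of y] by (subst summable_iff_shift)
    show "summable (\<lambda>n. y\<^sup>2 / 2 * q ^ n)"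
      using q by (intro summable_mult summable_geometric) auto
  qed
  also have "(\<Sum>n. y\<^sup>2 / 2 * q ^ n) = y\<^sup>2 / 2 * (1 / (1 - q))"
    using q by (subst suminf_mult) (auto simp: suminf_geometric summable_geometric)
  finally show ?thesis
    by (simp add: y_def q_def power_mult_distrib)
qed

section \<open>Spectral calculus and bounds on entries\<close>

lemma eigsys_add_idm:
  assumes "eigsys I A U a"
  shows "eigsys I (\<lambda>x y. idm x y + c * A x y) U (\<lambda>i. 1 + c * a i)"
  using assms orthonormal_complete[OF eigsysD(1,2)[OF assms]]
  by (simp add: eigsys_def idm_def algebra_simps sum.distrib sum_distrib_left)

lemma eigsys_scale: "eigsys I A U a \<Longrightarrow> eigsys I (\<lambda>x y. c * A x y) U (\<lambda>i. c * a i)"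
  by (simp add: eigsys_def sum_distrib_left mult.assoc)

lemma eigsys_square:
  "eigsys I A U a \<Longrightarrow> eigsys I (\<lambda>x y. \<Sum>z\<in>I. A x z * A z y) U (\<lambda>i. (a i)\<^sup>2)"
  using eigsys_mult[of I A U a _ _ a]
  by (simp add: eigsys_def power2_eq_square)

lemma eigenvalue_abs_le:
  assumes "eigsys I A U a" "i \<in> I" and "\<And>v. \<bar>bil I A v v\<bar> \<le> L * ip I v v"
  shows "\<bar>a i\<bar> \<le> L"
  using assms(3)[of "U i"] bil_eigvec[OF assms(1,2)] eigsysD(2)[OF assms(1)] assms(2)
  by (simp add: orthonormal_on_def)

text \<open>The arithmetic-geometric mean inequality applies to \<open>U i x * U i y\<close>, and
  the squares sum to 1 by completeness. Form bounds thereby yield bounded, hence integrable,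
  entries.\<close>

lemma entry_abs_le:
  assumes "eigsys I A U a" and L: "\<And>i. i \<in> I \<Longrightarrow> \<bar>a i\<bar> \<le> L" and xy: "x \<in> I" "y \<in> I"
  shows "\<bar>A x y\<bar> \<le> L"
proof -
  have one: "(\<Sum>i\<in>I. (U i z)\<^sup>2) = 1" if "z \<in> I" for z
    using orthonormal_complete[OF eigsysD(1,2)[OF assms(1)] that that] by (simp add: power2_eq_square)
  have "\<bar>A x y\<bar> \<le> (\<Sum>i\<in>I. \<bar>a i * U i x * U i y\<bar>)"
    using xy by (simp add: eigsysD(3)[OF assms(1)] sum_abs)
  also have "\<dots> \<le> (\<Sum>i\<in>I. L * (((U i x)\<^sup>2 + (U i y)\<^sup>2) / 2))"
  proof (rule sum_mono)
    fix i assume i: "i \<in> I"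
    have "0 \<le> (\<bar>U i x\<bar> - \<bar>U i y\<bar>)\<^sup>2" by simp
    then have "\<bar>U i x * U i y\<bar> \<le> ((U i x)\<^sup>2 + (U i y)\<^sup>2) / 2"
      by (simp add: power2_diff abs_mult)
    then show "\<bar>a i * U i x * U i y\<bar> \<le> L * (((U i x)\<^sup>2 + (U i y)\<^sup>2) / 2)"
      unfolding mult.assoc abs_mult[of "a i"] using L[OF i] by (intro mult_mono) auto
  qed
  also have "\<dots> = L"
    using one xy by (simp add: sum_distrib_left[symmetric] sum_divide_distrib[symmetric] sum.distrib)
  finally show ?thesis .
qed

text \<open>A crude constant suffices: it serves only to secure integrability and strict positivity
  of mean exponentials.\<close>

lemma exists_form_bound:
  assumes "finite I" "symmetric_on I A"
  obtains h where "0 \<le> h" "\<And>v. \<bar>bil I A v v\<bar> \<le> h * ip I v v"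
proof -
  obtain U a where U: "eigsys I A U a" using spectral_theorem assms by blast
  have "\<bar>bil I A v v\<bar> \<le> (\<Sum>i\<in>I. \<bar>a i\<bar>) * ip I v v" for v
  proof -
    have "\<bar>bil I A v v\<bar> \<le> (\<Sum>i\<in>I. \<bar>a i\<bar> * (ip I (U i) v * ip I (U i) v))"
      unfolding bil_eigsys[OF U] by (rule order_trans[OF sum_abs]) (simp add: abs_mult)
    also have "\<dots> \<le> (\<Sum>i\<in>I. \<bar>a i\<bar> * ip I v v)"
    proof (intro sum_mono mult_left_mono)
      fix i assume "i \<in> I"
      then show "ip I (U i) v * ip I (U i) v \<le> ip I v v"
        unfolding parseval[OF eigsysD(1,2)[OF U], of v v, symmetric]
        using assms by (intro member_le_sum) auto
    qed simp
    finally show ?thesis by (simp add: sum_distrib_right)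
  qed
  then show thesis using that[of "\<Sum>i\<in>I. \<bar>a i\<bar>"] by (simp add: sum_nonneg)
qed

lemma bil_add: "bil I (\<lambda>x y. A x y + B x y) v w = bil I A v w + bil I B v w"
  by (simp add: bil_def algebra_simps sum.distrib)

lemma bil_scale: "bil I (\<lambda>x y. c * A x y) v w = c * bil I A v w"
  by (simp add: bil_def sum_distrib_left mult_ac)

lemma symmetric_on_add_scale:
  "symmetric_on I A \<Longrightarrow> symmetric_on I B \<Longrightarrow> symmetric_on I (\<lambda>x y. A x y + c * B x y)"
  by (simp add: symmetric_on_def)

text \<open>With \<open>T = exp (H + \<theta> X)\<close> and \<open>A = exp (\<theta> X)\<close> the relative entropy is linear in \<open>T\<close> up to
  its own trace, so the tangent inequality bounds \<open>tr T\<close> by quantities linear in \<open>T\<close>, \<open>X\<close>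
  and \<open>X\<^sup>2\<close>, whose expectations are under control.\<close>
lemma trexp_le_linear:
  assumes fin: "finite I" and H: "symmetric_on I H" and X: "symmetric_on I X"
    and bnd: "\<And>v. \<bar>bil I X v v\<bar> \<le> L * ip I v v" and \<theta>: "0 \<le> \<theta>" "\<theta> * L < 3"
    and R: "\<And>v. 0 \<le> bil I R v v"
    and tangent: "entropy_minorant I P R"
  defines "g \<equiv> \<theta>\<^sup>2 / 2 / (1 - \<theta> * L / 3)"
  defines "T \<equiv> mexp I (\<lambda>x y. H x y + \<theta> * X x y)"
  shows "trexp I (\<lambda>x y. H x y + \<theta> * X x y) \<le> mip I T H + mip I T idm - mip I T P
    + (mip I R idm + \<theta> * mip I R X + g * mip I R (\<lambda>x y. \<Sum>z\<in>I. X x z * X z y))"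
proof -
  let ?S = "\<lambda>x y. H x y + \<theta> * X x y"
  obtain U s where S: "eigsys I ?S U s"
    using spectral_theorem[OF fin symmetric_on_add_scale[OF H X]] by blast
  obtain V a where V: "eigsys I X V a" using spectral_theorem[OF fin X] by blast
  have T: "eigsys I T U (\<lambda>i. exp (s i))" unfolding T_def by (rule mexp_eigsys[OF S])
  define A where "A = mexp I (\<lambda>x y. \<theta> * X x y)"
  have A: "eigsys I A V (\<lambda>i. exp (\<theta> * a i))"
    unfolding A_def by (rule mexp_eigsys[OF eigsys_scale[OF V]])
  \<comment> \<open>The relative entropy of \<open>T\<close> and \<open>A\<close>. Their logarithms
    are \<open>H + \<theta> X\<close> and \<open>\<theta> X\<close>, so the difference is
    \<open>H\<close> and the value is \<open>tr (T H)\<close>.\<close>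
  let ?D = "\<Sum>i\<in>I. \<Sum>j\<in>I. (ip I (U i) (V j))\<^sup>2 * (exp (s i) * (ln (exp (s i)) - ln (exp (\<theta> * a j))))"
  have "mip I T ?S = (\<Sum>i\<in>I. exp (s i) * s i)"
    unfolding mip_eigsys[OF T] by (simp add: bil_eigvec[OF S])
  moreover have "mip I T (\<lambda>x y. \<theta> * X x y) = (\<Sum>i\<in>I. \<Sum>j\<in>I. (ip I (U i) (V j))\<^sup>2 * (exp (s i) * (\<theta> * a j)))"
    by (rule mip_eigsys2[OF T eigsys_scale[OF V]])
  moreover have "?D = (\<Sum>i\<in>I. \<Sum>j\<in>I. (ip I (U i) (V j))\<^sup>2 * (exp (s i) * s i))
      - (\<Sum>i\<in>I. \<Sum>j\<in>I. (ip I (U i) (V j))\<^sup>2 * (exp (s i) * (\<theta> * a j)))"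
    by (simp add: sum_subtractf[symmetric] algebra_simps)
  ultimately have "?D = mip I T H"
    unfolding sum_weights(1)[OF T V] by (simp add: mip_add_right)
  moreover have "mip I T P - mip I A R \<le> ?D"
    using tangent[unfolded entropy_minorant_def, rule_format, OF T _ A] by simp
  ultimately have "trexp I ?S \<le> mip I T H + mip I T idm - mip I T P + mip I A R"
    by (simp add: trexp_eigsys[OF S] trace_eigsys(2)[OF T])
  also have "mip I A R = (\<Sum>j\<in>I. exp (\<theta> * a j) * bil I R (V j) (V j))"
    by (rule mip_eigsys[OF A])
  also have "\<dots> \<le> (\<Sum>j\<in>I. (1 + \<theta> * a j + g * (a j)\<^sup>2) * bil I R (V j) (V j))"
    unfolding g_def
    by (intro sum_mono mult_right_mono R exp_le_bernstein \<theta> eigenvalue_abs_le[OF V _ bnd])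
  also have "\<dots> = mip I idm R + \<theta> * mip I X R + g * mip I (\<lambda>x y. \<Sum>z\<in>I. X x z * X z y) R"
    \<comment> \<open>With factor 0 the kernel is the identity, diagonalized here in the basis
      \<open>V\<close> with all eigenvalues 1.\<close>
    using mip_eigsys[OF eigsys_add_idm[OF V, of 0]]
    by (simp add: mip_eigsys[OF V] mip_eigsys[OF eigsys_square[OF V]] algebra_simps sum.distrib sum_distrib_left)
  finally show ?thesis by (simp add: mip_commute[of I R])
qed

text \<open>A lower bound uniform in the sample survives the expectation. It keeps the eigenvalues
  of the mean exponential positive, as its role as base point of the entropy requires.\<close>

lemma bil_mexp_bounds:
  assumes "eigsys I A U a" and b: "\<And>i. i \<in> I \<Longrightarrow> \<bar>a i\<bar> \<le> b"
  shows "exp (- b) * ip I v v \<le> bil I (mexp I A) v v"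
proof -
  have "exp (- b) * ip I v v = (\<Sum>i\<in>I. exp (- b) * (ip I (U i) v * ip I (U i) v))"
    by (simp add: sum_distrib_left[symmetric] parseval[OF eigsysD(1,2)[OF assms(1)]])
  also have "\<dots> \<le> (\<Sum>i\<in>I. exp (a i) * (ip I (U i) v * ip I (U i) v))"
    using b by (intro sum_mono mult_right_mono) (auto simp: abs_le_iff minus_le_iff)
  finally show ?thesis by (simp add: bil_eigsys[OF mexp_eigsys[OF assms(1)]])
qed

section \<open>Measurability and integrability of random exponentials\<close>

lemma borel_measurable_mexp:
  assumes "\<And>x y. x \<in> I \<Longrightarrow> y \<in> I \<Longrightarrow> (\<lambda>w. S w x y) \<in> borel_measurable M" "x \<in> I" "y \<in> I"
  shows "(\<lambda>w. mexp I (S w) x y) \<in> borel_measurable M"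
proof -
  have "(\<lambda>w. mpow I (S w) n x y) \<in> borel_measurable M" if "x \<in> I" "y \<in> I" for n x y
    using that
  proof (induction n arbitrary: x y)
    case (Suc n)
    then show ?case by (auto intro!: borel_measurable_sum borel_measurable_times assms)
  qed simp
  then show ?thesis
    unfolding mexp_def using assms by (intro borel_measurable_suminf borel_measurable_divide) auto
qed

lemma borel_measurable_trexp:
  assumes "\<And>x y. x \<in> I \<Longrightarrow> y \<in> I \<Longrightarrow> (\<lambda>w. S w x y) \<in> borel_measurable M"
  shows "(\<lambda>w. trexp I (S w)) \<in> borel_measurable M"
  unfolding trexp_def by (intro borel_measurable_sum borel_measurable_mexp assms)

lemma integral_mip:
  assumes "\<And>x y. x \<in> I \<Longrightarrow> y \<in> I \<Longrightarrow> integrable M (\<lambda>w. T w x y)"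
  shows "integrable M (\<lambda>w. mip I (T w) B)"
    and "(\<integral>w. mip I (T w) B \<partial>M) = mip I (\<lambda>x y. \<integral>w. T w x y \<partial>M) B"
  using assms unfolding mip_def by (simp_all add: Bochner_Integration.integral_sum)

lemma (in prob_space) integrable_mexp:
  assumes fin: "finite I"
    and meas: "\<And>x y. x \<in> I \<Longrightarrow> y \<in> I \<Longrightarrow> random_variable borel (\<lambda>w. S w x y)"
    and sym: "\<And>w. w \<in> space M \<Longrightarrow> symmetric_on I (S w)"
    and bnd: "\<And>w v. w \<in> space M \<Longrightarrow> \<bar>bil I (S w) v v\<bar> \<le> b * ip I v v"
  shows "\<And>x y. x \<in> I \<Longrightarrow> y \<in> I \<Longrightarrow> integrable M (\<lambda>w. mexp I (S w) x y)"
    and "integrable M (\<lambda>w. trexp I (S w))"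
proof -
  show "integrable M (\<lambda>w. mexp I (S w) x y)" if xy: "x \<in> I" "y \<in> I" for x y
  proof (rule integrable_const_bound[where B = "exp b"])
    show "AE w in M. norm (mexp I (S w) x y) \<le> exp b"
    proof (intro AE_I2)
      fix w assume w: "w \<in> space M"
      obtain U s where U: "eigsys I (S w) U s" using spectral_theorem[OF fin sym[OF w]] by blast
      have "\<bar>s i\<bar> \<le> b" if "i \<in> I" for i by (rule eigenvalue_abs_le[OF U that bnd[OF w]])
      then show "norm (mexp I (S w) x y) \<le> exp b"
        unfolding real_norm_def using xy
        by (intro entry_abs_le[OF mexp_eigsys[OF U]]) (auto simp: abs_le_iff)
    qed
    show "random_variable borel (\<lambda>w. mexp I (S w) x y)"
      using xy by (intro borel_measurable_mexp meas)
  qed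
  then show "integrable M (\<lambda>w. trexp I (S w))"
    unfolding trexp_def by (intro Bochner_Integration.integrable_sum) auto
qed

text \<open>Averaging the bound of \<open>trexp_le_linear\<close> evaluates the minorant at its
  point of contact, where it may be exchanged for the relative entropy itself. What remains is an
  instance of the Gibbs inequality for \<open>T0\<close>, once \<open>ln A0\<close> is bounded by
  \<open>g W\<close>.\<close>

lemma (in prob_space) trexp_expectation_step:
  assumes fin: "finite I" and H: "symmetric_on I H"
    and meas: "\<And>x y. x \<in> I \<Longrightarrow> y \<in> I \<Longrightarrow> random_variable borel (\<lambda>w. X w x y)"
    and sym: "\<And>w. w \<in> space M \<Longrightarrow> symmetric_on I (X w)"
    and bnd: "\<And>w v. w \<in> space M \<Longrightarrow> \<bar>bil I (X w) v v\<bar> \<le> L * ip I v v"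
    and mean: "\<And>x y. x \<in> I \<Longrightarrow> y \<in> I \<Longrightarrow> expectation (\<lambda>w. X w x y) = 0"
    and \<theta>: "0 \<le> \<theta>" "\<theta> * L < 3"
  defines "g \<equiv> \<theta>\<^sup>2 / 2 / (1 - \<theta> * L / 3)"
  shows "expectation (\<lambda>w. trexp I (\<lambda>x y. H x y + \<theta> * X w x y))
      \<le> trexp I (\<lambda>x y. H x y + g * expectation (\<lambda>w. \<Sum>z\<in>I. X w x z * X w z y))"
proof -
  let ?S = "\<lambda>w x y. H x y + \<theta> * X w x y"
  let ?X2 = "\<lambda>w x y. \<Sum>z\<in>I. X w x z * X w z y"
  define T where "T w = mexp I (?S w)" for w
  define T0 where "T0 = (\<lambda>x y. expectation (\<lambda>w. T w x y))"
  define W where "W = (\<lambda>x y. expectation (\<lambda>w. ?X2 w x y))"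
  have symS: "symmetric_on I (?S w)" if "w \<in> space M" for w
    by (rule symmetric_on_add_scale[OF H sym[OF that]])
  obtain h where h: "0 \<le> h" "\<And>v. \<bar>bil I H v v\<bar> \<le> h * ip I v v"
    using exists_form_bound[OF fin H] by blast
  define b where "b = h + \<theta> * L"
  have bndS: "\<bar>bil I (?S w) v v\<bar> \<le> b * ip I v v" if "w \<in> space M" for w v
  proof -
    have "\<bar>bil I (?S w) v v\<bar> \<le> \<bar>bil I H v v\<bar> + \<theta> * \<bar>bil I (X w) v v\<bar>"
      unfolding bil_add bil_scale using \<theta> by (metis abs_mult abs_of_nonneg abs_triangle_ineq)
    also have "\<dots> \<le> h * ip I v v + \<theta> * (L * ip I v v)"
      using h(2) bnd[OF that] \<theta> by (intro add_mono mult_left_mono) auto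
    finally show ?thesis by (simp add: b_def algebra_simps)
  qed
  have T_sys: "\<exists>U s. eigsys I (?S w) U s \<and> (\<forall>i\<in>I. \<bar>s i\<bar> \<le> b)" if w: "w \<in> space M" for w
  proof -
    obtain U s where U: "eigsys I (?S w) U s" using spectral_theorem[OF fin symS[OF w]] by blast
    have "\<forall>i\<in>I. \<bar>s i\<bar> \<le> b" by (intro ballI eigenvalue_abs_le[OF U _ bndS[OF w]])
    with U show ?thesis by blast
  qed
  have measS: "random_variable borel (\<lambda>w. ?S w x y)" if "x \<in> I" "y \<in> I" for x y
    using meas[OF that] by simp
  have intT: "integrable M (\<lambda>w. T w x y)" if "x \<in> I" "y \<in> I" for x y
    unfolding T_def by (rule integrable_mexp(1)[OF fin measS symS bndS that])
  have intS: "integrable M (\<lambda>w. trexp I (?S w))"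
    by (rule integrable_mexp(2)[OF fin measS symS bndS])
  have Xbnd: "\<bar>X w x y\<bar> \<le> L" if w: "w \<in> space M" and "x \<in> I" "y \<in> I" for w x y
  proof -
    obtain V a where V: "eigsys I (X w) V a" using spectral_theorem[OF fin sym[OF w]] by blast
    show ?thesis
      using that by (intro entry_abs_le[OF V] eigenvalue_abs_le[OF V _ bnd]) auto
  qed
  have intX: "integrable M (\<lambda>w. X w x y)" if "x \<in> I" "y \<in> I" for x y
    using that Xbnd by (intro integrable_const_bound[where B = L] meas AE_I2) auto
  have intX2: "integrable M (\<lambda>w. ?X2 w x y)" if "x \<in> I" "y \<in> I" for x y
  proof (intro Bochner_Integration.integrable_sum integrable_const_bound[where B = "L * L"] AE_I2)
    fix z w assume "z \<in> I" "w \<in> space M"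
    then show "norm (X w x z * X w z y) \<le> L * L"
      unfolding real_norm_def abs_mult using that Xbnd by (intro mult_mono) (auto intro: order_trans[OF abs_ge_zero])
  qed (use that meas in auto)
  have symT0: "symmetric_on I T0"
    unfolding symmetric_on_def T0_def
  proof (intro ballI Bochner_Integration.integral_cong refl)
    fix x y w assume xy: "x \<in> I" "y \<in> I" and "w \<in> space M"
    from T_sys[OF this(3)] obtain U s where "eigsys I (?S w) U s" by blast
    from eigsys_symmetric[OF mexp_eigsys[OF this]] show "T w x y = T w y x"
      unfolding T_def using xy by (auto simp: symmetric_on_def)
  qed
  have symW: "symmetric_on I W"
    unfolding symmetric_on_def W_def
    by (intro ballI Bochner_Integration.integral_cong refl sum.cong)
      (use sym in \<open>auto simp: symmetric_on_def mult.commute\<close>)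
  obtain U0 t0 where T0: "eigsys I T0 U0 t0" using spectral_theorem[OF fin symT0] by blast
  obtain V0 k where W: "eigsys I W V0 k" using spectral_theorem[OF fin symW] by blast
  have t0: "0 < t0 i" if "i \<in> I" for i
  proof -
    have bil_mip: "bil I A (U0 i) (U0 i) = mip I A (\<lambda>x y. U0 i x * U0 i y)" for A
      by (simp add: bil_def mip_def mult_ac)
    have "exp (- b) = (\<integral>w. exp (- b) \<partial>M)" by (simp add: prob_space)
    also have "\<dots> \<le> (\<integral>w. bil I (T w) (U0 i) (U0 i) \<partial>M)"
    proof (rule integral_mono)
      fix w assume "w \<in> space M"
      from T_sys[OF this] obtain U s where U: "eigsys I (?S w) U s" "\<forall>i\<in>I. \<bar>s i\<bar> \<le> b" by blast
      have "exp (- b) * ip I (U0 i) (U0 i) \<le> bil I (T w) (U0 i) (U0 i)"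
        unfolding T_def using U(2) by (intro bil_mexp_bounds[OF U(1)]) auto
      then show "exp (- b) \<le> bil I (T w) (U0 i) (U0 i)"
        using eigsysD(2)[OF T0] that by (simp add: orthonormal_on_def)
    qed (auto simp: bil_mip intro!: integral_mip intT)
    also have "\<dots> = bil I T0 (U0 i) (U0 i)"
      unfolding bil_mip T0_def by (intro integral_mip(2) intT)
    also have "\<dots> = t0 i" by (rule bil_eigvec[OF T0 that])
    finally show ?thesis using exp_gt_zero[of "- b"] by linarith
  qed
  have k: "0 \<le> k i" if "i \<in> I" for i
  proof -
    have bil_mip: "bil I A (V0 i) (V0 i) = mip I A (\<lambda>x y. V0 i x * V0 i y)" for A
      by (simp add: bil_def mip_def mult_ac)
    have "0 \<le> (\<integral>w. bil I (?X2 w) (V0 i) (V0 i) \<partial>M)"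
    proof (rule integral_nonneg_AE, intro AE_I2)
      fix w assume "w \<in> space M"
      then obtain V a where V: "eigsys I (X w) V a" using spectral_theorem[OF fin sym] by blast
      show "0 \<le> bil I (?X2 w) (V0 i) (V0 i)"
        unfolding bil_eigsys[OF eigsys_square[OF V]] by (intro sum_nonneg) auto
    qed
    also have "\<dots> = bil I W (V0 i) (V0 i)"
      unfolding bil_mip W_def by (intro integral_mip(2) intX2)
    also have "\<dots> = k i" by (rule bil_eigvec[OF W that])
    finally show ?thesis .
  qed
  have g: "0 \<le> g" unfolding g_def using \<theta> by (intro divide_nonneg_nonneg) auto
  have gk: "0 \<le> g * k i" if "i \<in> I" for i using g k[OF that] by simp
  have A0: "eigsys I (\<lambda>x y. idm x y + g * W x y) V0 (\<lambda>i. 1 + g * k i)"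
    by (rule eigsys_add_idm[OF W])
  have a0: "0 < 1 + g * k i" if "i \<in> I" for i using gk[OF that] by simp
  obtain P R where R: "\<And>v. 0 \<le> bil I R v v"
    and tangent: "entropy_minorant I P R"
    and eq: "mip I T0 P - mip I (\<lambda>x y. idm x y + g * W x y) R
      = (\<Sum>i\<in>I. \<Sum>j\<in>I. (ip I (U0 i) (V0 j))\<^sup>2 * (t0 i * (ln (t0 i) - ln (1 + g * k j))))"
    using relative_entropy_tangent[OF T0 t0 A0 a0] by blast
  let ?lin = "\<lambda>w. mip I (T w) H + mip I (T w) idm - mip I (T w) P
    + (mip I idm R + \<theta> * mip I (X w) R + g * mip I (?X2 w) R)"
  have "expectation (\<lambda>w. trexp I (?S w)) \<le> expectation ?lin"
  proof (rule integral_mono)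
    show "integrable M (\<lambda>w. trexp I (?S w))" by (rule intS)
    show "integrable M ?lin"
      by (intro Bochner_Integration.integrable_add Bochner_Integration.integrable_diff
          integrable_mult_right integral_mip intT intX intX2 integrable_const)
    fix w assume w: "w \<in> space M"
    show "trexp I (?S w) \<le> ?lin w"
      using trexp_le_linear[OF fin H sym[OF w] bnd[OF w] \<theta> R tangent]
      by (simp add: T_def g_def mip_commute[of I R])
  qed
  also have "expectation ?lin = mip I T0 H + mip I T0 idm - mip I T0 P
      + (mip I idm R + \<theta> * mip I (\<lambda>x y. expectation (\<lambda>w. X w x y)) R + g * mip I W R)"
    using intT intX intX2
    by (simp add: integral_mip T0_def W_def prob_space)
  also have "mip I (\<lambda>x y. expectation (\<lambda>w. X w x y)) R = 0"
    by (simp add: mip_def mean)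
  also have "mip I T0 H + mip I T0 idm - mip I T0 P + (mip I idm R + \<theta> * 0 + g * mip I W R)
      = mip I T0 H + mip I T0 idm - (mip I T0 P - mip I (\<lambda>x y. idm x y + g * W x y) R)"
    by (simp add: mip_commute[of I _ R] mip_add_right mip_scale_right)
  also have "\<dots> = mip I T0 H + mip I T0 idm
      - (\<Sum>i\<in>I. \<Sum>j\<in>I. (ip I (U0 i) (V0 j))\<^sup>2 * (t0 i * (ln (t0 i) - ln (1 + g * k j))))"
    by (simp only: eq)
  also have "\<dots> = mip I T0 H + (\<Sum>i\<in>I. t0 i) - (\<Sum>i\<in>I. t0 i * ln (t0 i))
      + (\<Sum>i\<in>I. \<Sum>j\<in>I. (ip I (U0 i) (V0 j))\<^sup>2 * (t0 i * ln (1 + g * k j)))"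
    unfolding sum_weights(1)[OF T0 W, symmetric, of "\<lambda>i. t0 i * ln (t0 i)"]
    by (simp add: trace_eigsys(2)[OF T0] sum_subtractf right_diff_distrib)
  \<comment> \<open>\<open>ln (1 + x) \<le> x\<close> is applied to each eigenvalue:
    \<open>A0\<close> and \<open>g W\<close> share the eigenbasis \<open>V0\<close>, so no operator
    monotonicity is involved.\<close>
  also have "\<dots> \<le> mip I T0 H + (\<Sum>i\<in>I. t0 i) - (\<Sum>i\<in>I. t0 i * ln (t0 i))
      + (\<Sum>i\<in>I. \<Sum>j\<in>I. (ip I (U0 i) (V0 j))\<^sup>2 * (t0 i * (g * k j)))"
    by (intro add_left_mono sum_mono mult_left_mono ln_add_one_self_le_self gk)
      (auto intro: less_imp_le[OF t0])
  also have "(\<Sum>i\<in>I. \<Sum>j\<in>I. (ip I (U0 i) (V0 j))\<^sup>2 * (t0 i * (g * k j))) = mip I T0 (\<lambda>x y. g * W x y)"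
    by (rule mip_eigsys2[OF T0 eigsys_scale[OF W], symmetric])
  also have "mip I T0 H + (\<Sum>i\<in>I. t0 i) - (\<Sum>i\<in>I. t0 i * ln (t0 i)) + mip I T0 (\<lambda>x y. g * W x y)
      = mip I T0 (\<lambda>x y. H x y + g * W x y) + (\<Sum>i\<in>I. t0 i) - (\<Sum>i\<in>I. t0 i * ln (t0 i))"
    by (simp add: mip_add_right)
  also have "\<dots> \<le> trexp I (\<lambda>x y. H x y + g * W x y)"
    by (rule gibbs_variational[OF T0 t0 symmetric_on_add_scale[OF H symW]])
  finally show "expectation (\<lambda>w. trexp I (?S w)) \<le> trexp I (\<lambda>x y. H x y + g * W x y)" .
qed

section \<open>Sums of independent kernels\<close>

lemma trexp_cong:
  assumes "\<And>x y. x \<in> I \<Longrightarrow> y \<in> I \<Longrightarrow> A x y = B x y"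
  shows "trexp I A = trexp I B"
proof -
  have "mpow I A n x y = mpow I B n x y" if "x \<in> I" "y \<in> I" for n x y
    using that by (induction n arbitrary: x) (auto simp: assms intro!: sum.cong)
  then show ?thesis by (simp add: trexp_def mexp_def)
qed

lemma bil_sum: "bil I (\<lambda>x y. \<Sum>k\<in>K. A k x y) v w = (\<Sum>k\<in>K. bil I (A k) v w)"
proof -
  have "bil I (\<lambda>x y. \<Sum>k\<in>K. A k x y) v w = (\<Sum>x\<in>I. \<Sum>y\<in>I. \<Sum>k\<in>K. A k x y * v x * w y)"
    by (simp add: bil_def sum_distrib_right)
  also have "\<dots> = (\<Sum>x\<in>I. \<Sum>k\<in>K. \<Sum>y\<in>I. A k x y * v x * w y)"
    by (rule sum.cong[OF refl], rule sum.swap)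
  also have "\<dots> = (\<Sum>k\<in>K. \<Sum>x\<in>I. \<Sum>y\<in>I. A k x y * v x * w y)"
    by (rule sum.swap)
  finally show ?thesis by (simp add: bil_def)
qed

text \<open>Fubini on the product of the two distributions takes the place of conditioning on
  \<open>S\<close>: the hypothesis freezes \<open>S w\<close> and lets \<open>Z\<close> run over a
  fresh copy of \<open>M\<close>.\<close>

lemma (in prob_space) indep_var_integral_le:
  fixes F :: "'b \<times> 'b \<Rightarrow> real"
  assumes indep: "indep_var N S K Z" and F: "F \<in> borel_measurable (N \<Otimes>\<^sub>M K)"
    and int: "integrable M (\<lambda>w. F (S w, Z w))" "integrable M G"
    and le: "\<And>w. w \<in> space M \<Longrightarrow> (\<integral>w'. F (S w, Z w') \<partial>M) \<le> G w"
  shows "(\<integral>w. F (S w, Z w) \<partial>M) \<le> (\<integral>w. G w \<partial>M)"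
proof -
  have rv[measurable]: "S \<in> measurable M N" "Z \<in> measurable M K"
    and eq: "distr M N S \<Otimes>\<^sub>M distr M K Z = distr M (N \<Otimes>\<^sub>M K) (\<lambda>w. (S w, Z w))"
    using indep unfolding indep_var_distribution_eq by auto
  note F[measurable]
  interpret S: prob_space "distr M N S" by (rule prob_space_distr) simp
  interpret Z: prob_space "distr M K Z" by (rule prob_space_distr) simp
  interpret SZ: pair_sigma_finite "distr M N S" "distr M K Z" ..
  have intF: "integrable (distr M N S \<Otimes>\<^sub>M distr M K Z) F"
    unfolding eq using int(1) by (simp add: integrable_distr_eq)
  have inner: "(\<integral>z. F (s, z) \<partial>distr M K Z) = (\<integral>w'. F (s, Z w') \<partial>M)" if "s \<in> space N" for s
    using that by (intro integral_distr) simp_all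
  have meas: "(\<lambda>s. \<integral>z. F (s, z) \<partial>distr M K Z) \<in> borel_measurable N"
    by measurable
  have "integrable M (\<lambda>w. \<integral>z. F (S w, z) \<partial>distr M K Z)"
    using SZ.integrable_fst'[OF intF] meas by (simp add: integrable_distr_eq)
  then have int': "integrable M (\<lambda>w. \<integral>w'. F (S w, Z w') \<partial>M)"
    by (rule Bochner_Integration.integrable_cong[THEN iffD1, rotated 2])
      (auto simp: inner measurable_space[OF rv(1)])
  have "(\<integral>w. F (S w, Z w) \<partial>M) = integral\<^sup>L (distr M N S \<Otimes>\<^sub>M distr M K Z) F"
    unfolding eq by (simp add: integral_distr)
  also have "\<dots> = (\<integral>s. (\<integral>z. F (s, z) \<partial>distr M K Z) \<partial>distr M N S)"
    by (rule SZ.integral_fst'[OF intF, symmetric])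
  also have "\<dots> = (\<integral>w. (\<integral>z. F (S w, z) \<partial>distr M K Z) \<partial>M)"
    using meas by (simp add: integral_distr)
  also have "\<dots> = (\<integral>w. (\<integral>w'. F (S w, Z w') \<partial>M) \<partial>M)"
    by (intro Bochner_Integration.integral_cong refl inner measurable_space[OF rv(1)])
  also have "\<dots> \<le> (\<integral>w. G w \<partial>M)"
    by (intro integral_mono int' int(2) le)
  finally show ?thesis .
qed

text \<open>Independence concerns whole kernels as points of a product space. The
  \<open>restrict\<close> is there because \<open>Pi\<^sub>M\<close> consists of extensional
  functions.\<close>

locale indep_kernels = prob_space M for M :: "'w measure" +
  fixes I :: "'i set" and n :: nat and X :: "nat \<Rightarrow> 'w \<Rightarrow> 'i \<Rightarrow> 'i \<Rightarrow> real" and L :: real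
  assumes fin: "finite I"
    and indep: "indep_vars (\<lambda>_. Pi\<^sub>M (I \<times> I) (\<lambda>_. borel))
      (\<lambda>k w. restrict (\<lambda>(x, y). X k w x y) (I \<times> I)) {..<n}"
    and sym: "\<And>k w. k < n \<Longrightarrow> w \<in> space M \<Longrightarrow> symmetric_on I (X k w)"
    and bnd: "\<And>k w v. k < n \<Longrightarrow> w \<in> space M \<Longrightarrow> \<bar>bil I (X k w) v v\<bar> \<le> L * ip I v v"
    and mean: "\<And>k x y. k < n \<Longrightarrow> x \<in> I \<Longrightarrow> y \<in> I \<Longrightarrow> expectation (\<lambda>w. X k w x y) = 0"
begin

lemma meas:
  assumes "k < n" "x \<in> I" "y \<in> I"
  shows "random_variable borel (\<lambda>w. X k w x y)"
proof -
  have "random_variable (Pi\<^sub>M (I \<times> I) (\<lambda>_. borel)) (\<lambda>w. restrict (\<lambda>(x, y). X k w x y) (I \<times> I))"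
    using indep assms(1) by (simp add: indep_vars_def)
  from measurable_compose[OF this measurable_component_singleton[of "(x, y)"]]
  show ?thesis using assms by simp
qed

lemma integrable_entry:
  assumes "k < n" "x \<in> I" "y \<in> I"
  shows "integrable M (\<lambda>w. X k w x y)"
proof (rule integrable_const_bound[where B = L])
  show "AE w in M. norm (X k w x y) \<le> L"
  proof (rule AE_I2)
    fix w assume w: "w \<in> space M"
    obtain V a where V: "eigsys I (X k w) V a"
      using spectral_theorem[OF fin sym[OF assms(1) w]] by blast
    show "norm (X k w x y) \<le> L"
      unfolding real_norm_def
      by (intro entry_abs_le[OF V _ assms(2,3)] eigenvalue_abs_le[OF V _ bnd[OF assms(1) w]])
  qed
qed (rule meas[OF assms])

lemma indep_entries:
  assumes "j < n" "k < n" "j \<noteq> k" "x \<in> I" "y \<in> I" "x' \<in> I" "y' \<in> I"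
  shows "indep_var borel (\<lambda>w. X j w x y) borel (\<lambda>w. X k w x' y')"
proof -
  let ?Z = "\<lambda>k w. restrict (\<lambda>(x, y). X k w x y) (I \<times> I)"
  have "(\<lambda>f. f j (x, y)) \<in> borel_measurable (Pi\<^sub>M {j} (\<lambda>_. Pi\<^sub>M (I \<times> I) (\<lambda>_. borel :: real measure)))"
    using measurable_compose[OF measurable_component_singleton[of j "{j}"]
        measurable_component_singleton[of "(x, y)" "I \<times> I"]] assms by simp
  moreover have "(\<lambda>f. f k (x', y')) \<in> borel_measurable (Pi\<^sub>M {k} (\<lambda>_. Pi\<^sub>M (I \<times> I) (\<lambda>_. borel :: real measure)))"
    using measurable_compose[OF measurable_component_singleton[of k "{k}"]
        measurable_component_singleton[of "(x', y')" "I \<times> I"]] assms by simp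
  moreover have "indep_var (Pi\<^sub>M {j} (\<lambda>_. Pi\<^sub>M (I \<times> I) (\<lambda>_. borel))) (\<lambda>w. restrict (\<lambda>i. ?Z i w) {j})
      (Pi\<^sub>M {k} (\<lambda>_. Pi\<^sub>M (I \<times> I) (\<lambda>_. borel))) (\<lambda>w. restrict (\<lambda>i. ?Z i w) {k})"
    using assms by (intro indep_var_restrict[OF indep]) auto
  ultimately have "indep_var borel ((\<lambda>f. f j (x, y)) \<circ> (\<lambda>w. restrict (\<lambda>i. ?Z i w) {j}))
      borel ((\<lambda>f. f k (x', y')) \<circ> (\<lambda>w. restrict (\<lambda>i. ?Z i w) {k}))"
    by (intro indep_var_compose)
  then show ?thesis using assms by (simp add: comp_def)
qed

definition second_moment :: "nat \<Rightarrow> 'i \<Rightarrow> 'i \<Rightarrow> real" where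
  "second_moment k x y = expectation (\<lambda>w. \<Sum>z\<in>I. X k w x z * X k w z y)"

lemma integrable_entry_mult:
  assumes "j < n" "k < n" "x \<in> I" "y \<in> I" "x' \<in> I" "y' \<in> I"
  shows "integrable M (\<lambda>w. X j w x y * X k w x' y')"
proof (rule integrable_const_bound[where B = "L * L"])
  show "AE w in M. norm (X j w x y * X k w x' y') \<le> L * L"
  proof (rule AE_I2)
    fix w assume w: "w \<in> space M"
    have b: "\<bar>X k w x y\<bar> \<le> L" if k: "k < n" and "x \<in> I" "y \<in> I" for k x y
    proof -
      obtain V a where V: "eigsys I (X k w) V a"
        using spectral_theorem[OF fin sym[OF k w]] by blast
      show ?thesis
        using that by (intro entry_abs_le[OF V] eigenvalue_abs_le[OF V _ bnd[OF k w]])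
    qed
    show "norm (X j w x y * X k w x' y') \<le> L * L"
      unfolding real_norm_def abs_mult using b[OF assms(1,3,4)] b[OF assms(2,5,6)]
      by (intro mult_mono) auto
  qed
  show "random_variable borel (\<lambda>w. X j w x y * X k w x' y')"
    using meas[OF assms(1,3,4)] meas[OF assms(2,5,6)] by simp
qed

text \<open>Independent factors of mean zero have uncorrelated entries, so all mixed products
  vanish. This converts a bound on the second moment of the sum into one on the sum of second
  moments.\<close>

lemma second_moment_sum:
  assumes "x \<in> I" "y \<in> I"
  shows "expectation (\<lambda>w. \<Sum>z\<in>I. (\<Sum>k<n. X k w x z) * (\<Sum>k<n. X k w z y)) = (\<Sum>k<n. second_moment k x y)"
proof -
  have cross: "expectation (\<lambda>w. X j w x z * X k w z y) = (if j = k then expectation (\<lambda>w. X k w x z * X k w z y) else 0)"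
    if "j < n" "k < n" "z \<in> I" for j k z
    using that assms indep_var_lebesgue_integral[OF indep_entries integrable_entry integrable_entry, of j k x z z y]
    by (auto simp: mean)
  have int: "integrable M (\<lambda>w. X j w x z * X k w z y)" if "j \<in> {..<n}" "k \<in> {..<n}" "z \<in> I" for j k z
    using that assms by (intro integrable_entry_mult) auto
  have "expectation (\<lambda>w. \<Sum>z\<in>I. (\<Sum>k<n. X k w x z) * (\<Sum>k<n. X k w z y))
      = expectation (\<lambda>w. \<Sum>z\<in>I. \<Sum>j<n. \<Sum>k<n. X j w x z * X k w z y)"
    by (simp add: sum_product)
  also have "\<dots> = (\<Sum>z\<in>I. expectation (\<lambda>w. \<Sum>j<n. \<Sum>k<n. X j w x z * X k w z y))"
    by (intro Bochner_Integration.integral_sum Bochner_Integration.integrable_sum int)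
  also have "\<dots> = (\<Sum>z\<in>I. \<Sum>j<n. expectation (\<lambda>w. \<Sum>k<n. X j w x z * X k w z y))"
    by (intro sum.cong refl Bochner_Integration.integral_sum Bochner_Integration.integrable_sum int)
  also have "\<dots> = (\<Sum>z\<in>I. \<Sum>j<n. \<Sum>k<n. expectation (\<lambda>w. X j w x z * X k w z y))"
    by (intro sum.cong refl Bochner_Integration.integral_sum int)
  also have "\<dots> = (\<Sum>z\<in>I. \<Sum>k<n. expectation (\<lambda>w. X k w x z * X k w z y))"
  proof (rule sum.cong[OF refl])
    fix z assume "z \<in> I"
    then have "(\<Sum>j<n. \<Sum>k<n. expectation (\<lambda>w. X j w x z * X k w z y))
        = (\<Sum>j<n. \<Sum>k<n. if j = k then expectation (\<lambda>w. X k w x z * X k w z y) else 0)"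
      by (intro sum.cong refl cross) auto
    then show "(\<Sum>j<n. \<Sum>k<n. expectation (\<lambda>w. X j w x z * X k w z y))
        = (\<Sum>k<n. expectation (\<lambda>w. X k w x z * X k w z y))"
      by simp
  qed
  also have "\<dots> = (\<Sum>k<n. second_moment k x y)"
    unfolding second_moment_def
    by (subst sum.swap) (intro sum.cong refl Bochner_Integration.integral_sum[symmetric] int)
  finally show ?thesis .
qed

lemma second_moment_symmetric: "k < n \<Longrightarrow> symmetric_on I (second_moment k)"
  unfolding symmetric_on_def second_moment_def
  by (intro ballI Bochner_Integration.integral_cong refl sum.cong)
    (use sym in \<open>auto simp: symmetric_on_def mult.commute\<close>)

lemma partial_sum_props:
  assumes "m \<le> n" "symmetric_on I H" "0 \<le> \<theta>"
  shows "\<And>x y. x \<in> I \<Longrightarrow> y \<in> I \<Longrightarrow> random_variable borel (\<lambda>w. H x y + \<theta> * (\<Sum>k<m. X k w x y))"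
    and "\<And>w. w \<in> space M \<Longrightarrow> symmetric_on I (\<lambda>x y. H x y + \<theta> * (\<Sum>k<m. X k w x y))"
    and "integrable M (\<lambda>w. trexp I (\<lambda>x y. H x y + \<theta> * (\<Sum>k<m. X k w x y)))"
proof -
  show ms: "random_variable borel (\<lambda>w. H x y + \<theta> * (\<Sum>k<m. X k w x y))" if "x \<in> I" "y \<in> I" for x y
    using that assms(1) by (intro borel_measurable_add borel_measurable_times borel_measurable_sum meas) auto
  show sy: "symmetric_on I (\<lambda>x y. H x y + \<theta> * (\<Sum>k<m. X k w x y))" if "w \<in> space M" for w
    using sym[OF _ that] assms(1,2) by (auto simp: symmetric_on_def intro!: sum.cong)
  obtain h where h: "\<And>v. \<bar>bil I H v v\<bar> \<le> h * ip I v v"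
    using exists_form_bound[OF fin assms(2)] by blast
  have "\<bar>bil I (\<lambda>x y. H x y + \<theta> * (\<Sum>k<m. X k w x y)) v v\<bar> \<le> (h + \<theta> * (real m * L)) * ip I v v"
    if "w \<in> space M" for w v
  proof -
    have "\<bar>\<Sum>k<m. bil I (X k w) v v\<bar> \<le> (\<Sum>k<m. L * ip I v v)"
      using bnd[OF _ that] assms(1) by (intro order_trans[OF sum_abs] sum_mono) auto
    then have "\<theta> * \<bar>\<Sum>k<m. bil I (X k w) v v\<bar> \<le> \<theta> * (real m * L * ip I v v)"
      using assms(3) by (intro mult_left_mono) auto
    moreover have "\<bar>bil I (\<lambda>x y. H x y + \<theta> * (\<Sum>k<m. X k w x y)) v v\<bar>
        \<le> \<bar>bil I H v v\<bar> + \<theta> * \<bar>\<Sum>k<m. bil I (X k w) v v\<bar>"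
      unfolding bil_add bil_scale bil_sum using assms(3)
      by (metis abs_mult abs_of_nonneg abs_triangle_ineq)
    ultimately show ?thesis using h[of v] by (simp add: algebra_simps)
  qed
  then show "integrable M (\<lambda>w. trexp I (\<lambda>x y. H x y + \<theta> * (\<Sum>k<m. X k w x y)))"
    by (intro integrable_mexp(2) fin ms sy)
qed

text \<open>The last summand is averaged while the others are frozen inside the deterministic
  kernel. Its replacement \<open>g * second_moment m\<close> is then absorbed into \<open>H\<close>,
  which is why the induction runs over arbitrary \<open>H\<close>.\<close>

lemma expectation_trexp_sum_le:
  assumes \<theta>: "0 \<le> \<theta>" "\<theta> * L < 3" and "m \<le> n" "symmetric_on I H"
  defines "g \<equiv> \<theta>\<^sup>2 / 2 / (1 - \<theta> * L / 3)"
  shows "expectation (\<lambda>w. trexp I (\<lambda>x y. H x y + \<theta> * (\<Sum>k<m. X k w x y)))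
    \<le> trexp I (\<lambda>x y. H x y + g * (\<Sum>k<m. second_moment k x y))"
  using assms(3,4)
proof (induction m arbitrary: H)
  case 0
  then show ?case by (simp add: prob_space)
next
  case (Suc m)
  let ?N = "Pi\<^sub>M (I \<times> I) (\<lambda>_. borel :: real measure)"
  let ?Z = "\<lambda>k w. restrict (\<lambda>(x, y). X k w x y) (I \<times> I)"
  define S where "S w = restrict (\<lambda>(x, y). \<Sum>k<m. X k w x y) (I \<times> I)" for w
  \<comment> \<open>The trace as a function of the pair (partial sum, next kernel), the shape that
    \<open>indep_var_integral_le\<close> expects.\<close>
  define F where "F p = trexp I (\<lambda>x y. H x y + \<theta> * (fst p (x, y) + snd p (x, y)))" for p :: "('i \<times> 'i \<Rightarrow> real) \<times> ('i \<times> 'i \<Rightarrow> real)"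
  define H' where "H' = (\<lambda>x y. H x y + g * second_moment m x y)"
  have m: "m < n" using Suc.prems by simp
  have H': "symmetric_on I H'"
    unfolding H'_def by (rule symmetric_on_add_scale[OF Suc.prems(2) second_moment_symmetric[OF m]])
  have "indep_var ?N ((\<lambda>f. restrict (\<lambda>p. \<Sum>k<m. f k p) (I \<times> I)) \<circ> (\<lambda>w. restrict (\<lambda>i. ?Z i w) {..<m}))
      ?N ((\<lambda>f. f m) \<circ> (\<lambda>w. restrict (\<lambda>i. ?Z i w) {m}))"
  proof (rule indep_var_compose[OF indep_var_restrict[OF indep]])
    show "(\<lambda>f. restrict (\<lambda>p. \<Sum>k<m. f k p) (I \<times> I)) \<in> measurable (Pi\<^sub>M {..<m} (\<lambda>_. ?N)) ?N"
    proof (intro measurable_restrict borel_measurable_sum)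
      fix p k assume p: "p \<in> I \<times> I" and "k \<in> {..<m}"
      then have "(\<lambda>f. f k) \<in> measurable (Pi\<^sub>M {..<m} (\<lambda>_. ?N)) ?N"
        by (intro measurable_component_singleton)
      then show "(\<lambda>f. f k p) \<in> borel_measurable (Pi\<^sub>M {..<m} (\<lambda>_. ?N))"
        by (rule measurable_compose) (rule measurable_component_singleton[OF p])
    qed
    show "(\<lambda>f. f m) \<in> measurable (Pi\<^sub>M {m} (\<lambda>_. ?N)) ?N"
      by (rule measurable_component_singleton) simp
  qed (use m in auto)
  moreover have "(\<lambda>f. restrict (\<lambda>p. \<Sum>k<m. f k p) (I \<times> I)) \<circ> (\<lambda>w. restrict (\<lambda>i. ?Z i w) {..<m}) = S"
    by (auto simp: S_def fun_eq_iff)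
  moreover have "(\<lambda>f. f m) \<circ> (\<lambda>w. restrict (\<lambda>i. ?Z i w) {m}) = ?Z m"
    by (auto simp: fun_eq_iff)
  ultimately have ind: "indep_var ?N S ?N (?Z m)" by simp
  have F_meas: "F \<in> borel_measurable (?N \<Otimes>\<^sub>M ?N)"
    unfolding F_def
  proof (intro borel_measurable_trexp borel_measurable_add borel_measurable_times borel_measurable_const)
    fix x y assume "x \<in> I" "y \<in> I"
    then have c: "(\<lambda>f. f (x, y)) \<in> borel_measurable ?N"
      by (intro measurable_component_singleton) simp
    show "(\<lambda>p. fst p (x, y)) \<in> borel_measurable (?N \<Otimes>\<^sub>M ?N)"
      by (rule measurable_compose[OF measurable_fst c])
    show "(\<lambda>p. snd p (x, y)) \<in> borel_measurable (?N \<Otimes>\<^sub>M ?N)"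
      by (rule measurable_compose[OF measurable_snd c])
  qed
  have F_eq: "F (S w, ?Z m w') = trexp I (\<lambda>x y. (H x y + \<theta> * (\<Sum>k<m. X k w x y)) + \<theta> * X m w' x y)" for w w'
    unfolding F_def S_def by (rule trexp_cong) (simp add: algebra_simps)
  have F_diag: "F (S w, ?Z m w) = trexp I (\<lambda>x y. H x y + \<theta> * (\<Sum>k<Suc m. X k w x y))" for w
    unfolding F_eq by (rule trexp_cong) (simp add: algebra_simps)
  have "expectation (\<lambda>w. F (S w, ?Z m w)) \<le> expectation (\<lambda>w. trexp I (\<lambda>x y. H' x y + \<theta> * (\<Sum>k<m. X k w x y)))"
  proof (rule indep_var_integral_le[OF ind F_meas])
    show "integrable M (\<lambda>w. F (S w, ?Z m w))"
      unfolding F_diag by (rule partial_sum_props(3)[OF Suc.prems \<theta>(1)])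
    show "integrable M (\<lambda>w. trexp I (\<lambda>x y. H' x y + \<theta> * (\<Sum>k<m. X k w x y)))"
      using m by (intro partial_sum_props(3) H' \<theta>) simp
    fix w assume w: "w \<in> space M"
    \<comment> \<open>For fixed \<open>w\<close> the partial sum is deterministic and plays the role
      of \<open>H\<close> in the one-summand estimate.\<close>
    have "expectation (\<lambda>w'. F (S w, ?Z m w'))
      \<le> trexp I (\<lambda>x y. (H x y + \<theta> * (\<Sum>k<m. X k w x y)) + g * second_moment m x y)"
      unfolding F_eq g_def second_moment_def
      using m w by (intro trexp_expectation_step fin partial_sum_props(2) Suc.prems meas sym bnd mean \<theta>) auto
    also have "\<dots> = trexp I (\<lambda>x y. H' x y + \<theta> * (\<Sum>k<m. X k w x y))"
      by (rule trexp_cong) (simp add: H'_def)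
    finally show "expectation (\<lambda>w'. F (S w, ?Z m w')) \<le> trexp I (\<lambda>x y. H' x y + \<theta> * (\<Sum>k<m. X k w x y))" .
  qed
  also have "\<dots> \<le> trexp I (\<lambda>x y. H' x y + g * (\<Sum>k<m. second_moment k x y))"
    using m by (intro Suc.IH H') simp
  also have "\<dots> = trexp I (\<lambda>x y. H x y + g * (\<Sum>k<Suc m. second_moment k x y))"
    by (rule trexp_cong) (simp add: H'_def algebra_simps)
  finally show ?case unfolding F_diag .
qed

end

section \<open>Tail bound with intrinsic dimension\<close>

text \<open>Equivalent to \<open>3 exp x \<ge> 4 (x + 1)\<close>. The cubic Taylor polynomial
  already suffices: it leaves \<open>(x - 1) (x^2 / 2 + 2 x + 1)\<close>, which vanishes exactly at
  the threshold 1.\<close>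

lemma exp_ratio_bound:
  fixes x :: real
  assumes "1 \<le> x"
  shows "exp x \<le> 4 * (exp x - x - 1)"
proof -
  have "(\<Sum>k<4. inverse (fact k) * x ^ k) \<le> (\<Sum>k. inverse (fact k) * x ^ k)"
    using assms summable_exp[of x] by (intro sum_le_suminf) auto
  also have "\<dots> = exp x" by (simp add: exp_def)
  finally have "1 + x + x\<^sup>2 / 2 + x ^ 3 / 6 \<le> exp x"
    by (simp add: eval_nat_numeral field_simps)
  moreover have "0 \<le> x ^ 3 / 2 + 3 * x\<^sup>2 / 2 - x - 1"
  proof -
    have "0 \<le> (x - 1) * (x\<^sup>2 / 2 + 2 * x + 1)"
      using assms by (intro mult_nonneg_nonneg add_nonneg_nonneg) auto
    also have "\<dots> = x ^ 3 / 2 + 3 * x\<^sup>2 / 2 - x - 1"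
      by (simp add: field_simps power2_eq_square power3_eq_cube)
    finally show ?thesis .
  qed
  ultimately show ?thesis by simp
qed

lemma exp_minus_one_le_chord:
  fixes x c g :: real
  assumes "0 \<le> x" "x \<le> c" "0 < c"
  shows "exp (g * x) - 1 \<le> x / c * (exp (g * c) - 1)"
proof -
  have "exp ((1 - x / c) * 0 + (x / c) * (g * c)) \<le> (1 - x / c) * exp 0 + (x / c) * exp (g * c)"
    using assms convex_onD[OF exp_convex, of "x / c" 0 "g * c"] by simp
  moreover have "(1 - x / c) * 0 + (x / c) * (g * c) = g * x" using assms by simp
  ultimately show ?thesis by (simp add: algebra_simps)
qed

lemma exp_minus_linear_mono:
  fixes s t \<theta> :: real
  assumes "0 \<le> \<theta>" "0 \<le> t" "t \<le> s"
  shows "exp (\<theta> * t) - \<theta> * t - 1 \<le> exp (\<theta> * s) - \<theta> * s - 1"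
proof -
  have "\<theta> * (s - t) \<le> exp (\<theta> * t) * (exp (\<theta> * (s - t)) - 1)"
  proof -
    have "\<theta> * (s - t) \<le> exp (\<theta> * (s - t)) - 1"
      using exp_ge_add_one_self[of "\<theta> * (s - t)"] by linarith
    also have "\<dots> \<le> exp (\<theta> * t) * (exp (\<theta> * (s - t)) - 1)"
      using assms mult_right_mono[of 1 "exp (\<theta> * t)" "exp (\<theta> * (s - t)) - 1"] by simp
    finally show ?thesis .
  qed
  also have "\<dots> = exp (\<theta> * s) - exp (\<theta> * t)"
    by (simp add: algebra_simps exp_add[symmetric])
  finally show ?thesis by (simp add: algebra_simps)
qed

lemma exists_eigenvalue_ge:
  assumes U: "eigsys I A U a" and v: "ip I v v = 1" "t \<le> bil I A v v"
  shows "\<exists>i\<in>I. t \<le> a i"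
proof (rule ccontr)
  assume "\<not> ?thesis"
  then have lt: "a i < t" if "i \<in> I" for i using that by auto
  have one: "(\<Sum>i\<in>I. ip I (U i) v * ip I (U i) v) = 1"
    using parseval[OF eigsysD(1,2)[OF U], of v v] v(1) by simp
  then obtain i where i: "i \<in> I" "ip I (U i) v \<noteq> 0"
    by (metis (no_types, lifting) mult_zero_left sum.neutral zero_neq_one)
  have "bil I A v v < (\<Sum>i\<in>I. t * (ip I (U i) v * ip I (U i) v))"
    unfolding bil_eigsys[OF U]
  proof (rule sum_strict_mono_ex1)
    show "finite I" by (rule eigsysD(1)[OF U])
    show "\<forall>i\<in>I. a i * (ip I (U i) v * ip I (U i) v) \<le> t * (ip I (U i) v * ip I (U i) v)"
      using lt by (intro ballI mult_right_mono) (auto intro: less_imp_le)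
    show "\<exists>i\<in>I. a i * (ip I (U i) v * ip I (U i) v) < t * (ip I (U i) v * ip I (U i) v)"
      using lt i by (intro bexI[of _ i] mult_strict_right_mono) (auto simp: zero_less_mult_iff)
  qed
  also have "\<dots> = t" using one by (simp add: sum_distrib_left[symmetric])
  finally show False using v(2) by simp
qed

context indep_kernels
begin

abbreviation total :: "'w \<Rightarrow> 'i \<Rightarrow> 'i \<Rightarrow> real" where
  "total w \<equiv> (\<lambda>x y. \<Sum>k<n. X k w x y)"

theorem bernstein_tail:
  assumes V: "symmetric_on I V"
    and dom: "\<And>v. bil I (\<lambda>x y. \<Sum>k<n. second_moment k x y) v v \<le> bil I V v v"
    and V_le: "\<And>v. bil I V v v \<le> \<nu> * ip I v v" and \<nu>: "0 < \<nu>"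
    and L: "0 \<le> L" and t: "sqrt \<nu> + L / 3 \<le> t"
    and A: "A \<subseteq> space M" "\<And>w. w \<in> A \<Longrightarrow> \<exists>v. ip I v v = 1 \<and> t \<le> bil I (total w) v v"
  shows "measure M A \<le> 4 * ((\<Sum>x\<in>I. V x x) / \<nu>) * exp (- (t\<^sup>2) / 2 / (\<nu> + L * t / 3))"
proof -
  have t0: "0 < t" using t L \<nu> by (intro less_le_trans[OF _ t] add_pos_nonneg) auto
  define \<sigma> where "\<sigma> = \<nu> + L * t / 3"
  \<comment> \<open>This choice gives \<open>1 - \<theta> L / 3 = \<nu> / \<sigma>\<close>, hence
    \<open>g \<nu> = t^2 / (2 \<sigma>)\<close>, half of \<open>\<theta> t\<close>. The difference
    \<open>g \<nu> - \<theta> t\<close> is then the desired exponent.\<close>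
  define \<theta> where "\<theta> = t / \<sigma>"
  define g where "g = \<theta>\<^sup>2 / 2 / (1 - \<theta> * L / 3)"
  have \<sigma>: "0 < \<sigma>" unfolding \<sigma>_def using \<nu> L t0 by (intro add_pos_nonneg) auto
  have \<theta>: "0 \<le> \<theta>" "\<theta> * L < 3"
    using \<sigma> t0 \<nu> by (auto simp: \<theta>_def field_simps \<sigma>_def)
  have one_minus: "1 - \<theta> * L / 3 = \<nu> / \<sigma>"
    using \<sigma> by (simp add: \<theta>_def field_simps) (simp add: \<sigma>_def field_simps)
  have g\<nu>: "g * \<nu> = t\<^sup>2 / 2 / \<sigma>"
    unfolding g_def one_minus using \<nu> \<sigma> by (simp add: \<theta>_def power2_eq_square field_simps)
  have g0: "0 \<le> g" unfolding g_def one_minus using \<nu> \<sigma> by simp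
  \<comment> \<open>The lower bound on \<open>t\<close> enters here: both \<open>t\<close> and
    \<open>t - L / 3\<close> are at least \<open>sqrt \<nu>\<close>, so
    \<open>\<sigma> \<le> t^2\<close>. The factor 4 relies on this.\<close>
  have \<theta>t1: "1 \<le> \<theta> * t"
  proof -
    have "0 \<le> sqrt \<nu>" using \<nu> by simp
    have "\<nu> = sqrt \<nu> * sqrt \<nu>" using \<nu> by simp
    also have "\<dots> \<le> t * (t - L / 3)"
      using t L t0 \<open>0 \<le> sqrt \<nu>\<close> by (intro mult_mono) auto
    finally have "\<sigma> \<le> t * t" by (simp add: \<sigma>_def algebra_simps)
    then show ?thesis using \<sigma> by (simp add: \<theta>_def)
  qed
  \<comment> \<open>Nonnegative everywhere and increasing on the nonnegative axis, so a single
    eigenvalue of size at least \<open>t\<close> already forces the trace \<open>Z\<close> up to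
    \<open>\<psi> t\<close>.\<close>
  define \<psi> where "\<psi> s = exp (\<theta> * s) - \<theta> * s - 1" for s
  \<comment> \<open>The summand 0 stands for the kernel \<open>H\<close> of the general estimates,
    kept explicit so that they match.\<close>
  define Z where "Z w = trexp I (\<lambda>x y. 0 + \<theta> * total w x y) - \<theta> * (\<Sum>x\<in>I. total w x x) - real (card I)" for w
  have sym0: "symmetric_on I (\<lambda>x y. 0)" by (simp add: symmetric_on_def)
  have sym_total: "symmetric_on I (total w)" if "w \<in> space M" for w
    using sym[OF _ that] by (auto simp: symmetric_on_def intro!: sum.cong)
  have Z_eq: "Z w = (\<Sum>i\<in>I. \<psi> (s i))" if "eigsys I (total w) U s" for w U s
    unfolding Z_def \<psi>_def
    using trexp_eigsys[OF eigsys_scale[OF that, of \<theta>]] trace_eigsys(1)[OF that]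
    by (simp add: sum_subtractf sum_distrib_left)
  have \<psi>0: "0 \<le> \<psi> s" for s
    unfolding \<psi>_def using exp_ge_add_one_self[of "\<theta> * s"] by linarith
  have Z0: "0 \<le> Z w" if w: "w \<in> space M" for w
  proof -
    obtain U s where U: "eigsys I (total w) U s" using spectral_theorem[OF fin sym_total[OF w]] by blast
    show ?thesis unfolding Z_eq[OF U] by (intro sum_nonneg \<psi>0)
  qed
  have Zt: "\<psi> t \<le> Z w" if w: "w \<in> A" for w
  proof -
    obtain U s where U: "eigsys I (total w) U s"
      using spectral_theorem[OF fin sym_total] A(1) w by blast
    obtain i where i: "i \<in> I" "t \<le> s i"
      using exists_eigenvalue_ge[OF U] A(2)[OF w] by blast
    have "\<psi> t \<le> \<psi> (s i)"
      unfolding \<psi>_def using \<theta>(1) t0 i(2) by (intro exp_minus_linear_mono) auto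
    also have "\<dots> \<le> (\<Sum>i\<in>I. \<psi> (s i))"
      using i(1) fin by (intro member_le_sum \<psi>0)
    finally show ?thesis unfolding Z_eq[OF U] .
  qed
  have int_tr: "integrable M (\<lambda>w. trexp I (\<lambda>x y. 0 + \<theta> * total w x y))"
    by (rule partial_sum_props(3)[OF le_refl sym0 \<theta>(1)])
  have int_diag: "integrable M (\<lambda>w. \<Sum>x\<in>I. total w x x)"
    by (intro Bochner_Integration.integrable_sum integrable_entry) auto
  have int_Z: "integrable M Z"
    unfolding Z_def by (intro Bochner_Integration.integrable_diff int_tr integrable_mult_right int_diag integrable_const)
  have \<psi>t: "0 < \<psi> t"
    using less_le_trans[OF exp_gt_zero exp_ratio_bound[OF \<theta>t1]] unfolding \<psi>_def by simp
  have "expectation (\<lambda>w. \<Sum>x\<in>I. total w x x) = (\<Sum>x\<in>I. \<Sum>k<n. expectation (\<lambda>w. X k w x x))"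
  proof -
    have "expectation (\<lambda>w. \<Sum>x\<in>I. total w x x) = (\<Sum>x\<in>I. expectation (\<lambda>w. total w x x))"
      by (intro Bochner_Integration.integral_sum Bochner_Integration.integrable_sum integrable_entry) auto
    also have "\<dots> = (\<Sum>x\<in>I. \<Sum>k<n. expectation (\<lambda>w. X k w x x))"
      by (intro sum.cong refl Bochner_Integration.integral_sum integrable_entry) auto
    finally show ?thesis .
  qed
  also have "\<dots> = 0" by (intro sum.neutral ballI mean) auto
  finally have mean_diag: "expectation (\<lambda>w. \<Sum>x\<in>I. total w x x) = 0" .
  obtain W c where W: "eigsys I V W c" using spectral_theorem[OF fin V] by blast
  \<comment> \<open>The chord bound needs the spectrum of \<open>V\<close> inside
    \<open>[0, \<nu>]\<close>. Nonnegativity is inherited from the second moments that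
    \<open>V\<close> dominates.\<close>
  have c: "0 \<le> c i" "c i \<le> \<nu>" if "i \<in> I" for i
  proof -
    have "0 \<le> bil I (\<lambda>x y. \<Sum>k<n. second_moment k x y) (W i) (W i)"
      unfolding bil_sum
    proof (rule sum_nonneg)
      fix k assume k: "k \<in> {..<n}"
      have "bil I (second_moment k) (W i) (W i) = mip I (second_moment k) (\<lambda>x y. W i x * W i y)"
        by (simp add: bil_def mip_def mult_ac)
      also have "\<dots> = expectation (\<lambda>w. mip I (\<lambda>x y. \<Sum>z\<in>I. X k w x z * X k w z y) (\<lambda>x y. W i x * W i y))"
        unfolding second_moment_def using k
        by (intro integral_mip(2)[symmetric] Bochner_Integration.integrable_sum integrable_entry_mult) auto
      also have "0 \<le> \<dots>"
      proof (intro Bochner_Integration.integral_nonneg)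
        fix w assume w: "w \<in> space M"
        have "k < n" using k by simp
        obtain V a where V: "eigsys I (X k w) V a"
          using spectral_theorem[OF fin sym[OF \<open>k < n\<close> w]] by blast
        have "0 \<le> bil I (\<lambda>x y. \<Sum>z\<in>I. X k w x z * X k w z y) (W i) (W i)"
          unfolding bil_eigsys[OF eigsys_square[OF V]] by (intro sum_nonneg) auto
        then show "0 \<le> mip I (\<lambda>x y. \<Sum>z\<in>I. X k w x z * X k w z y) (\<lambda>x y. W i x * W i y)"
          by (simp add: bil_def mip_def mult_ac)
      qed
      finally show "0 \<le> bil I (second_moment k) (W i) (W i)" .
    qed
    also have "\<dots> \<le> bil I V (W i) (W i)" by (rule dom)
    finally show "0 \<le> c i" by (simp add: bil_eigvec[OF W that])
    show "c i \<le> \<nu>"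
      using V_le[of "W i"] eigsysD(2)[OF W] that by (simp add: bil_eigvec[OF W] orthonormal_on_def)
  qed
  have "expectation Z = expectation (\<lambda>w. trexp I (\<lambda>x y. 0 + \<theta> * total w x y)) - real (card I)"
    unfolding Z_def using int_tr int_diag mean_diag by (simp add: prob_space)
  also have "expectation (\<lambda>w. trexp I (\<lambda>x y. 0 + \<theta> * total w x y))
      \<le> trexp I (\<lambda>x y. 0 + g * (\<Sum>k<n. second_moment k x y))"
    unfolding g_def by (rule expectation_trexp_sum_le[OF \<theta> le_refl sym0])
  also have "\<dots> \<le> trexp I (\<lambda>x y. 0 + g * V x y)"
  proof (rule trexp_mono[OF fin])
    show "symmetric_on I (\<lambda>x y. 0 + g * (\<Sum>k<n. second_moment k x y))"
      using second_moment_symmetric by (auto simp: symmetric_on_def intro!: sum.cong)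
    show "symmetric_on I (\<lambda>x y. 0 + g * V x y)" by (rule symmetric_on_add_scale[OF sym0 V])
    show "bil I (\<lambda>x y. 0 + g * (\<Sum>k<n. second_moment k x y)) v v \<le> bil I (\<lambda>x y. 0 + g * V x y) v v" for v
      using mult_left_mono[OF dom g0, of v] by (simp add: bil_scale)
  qed
  also have "trexp I (\<lambda>x y. 0 + g * V x y) - real (card I) = (\<Sum>i\<in>I. exp (g * c i) - 1)"
    using trexp_eigsys[OF eigsys_scale[OF W, of g]] by (simp add: sum_subtractf)
  also have "\<dots> \<le> (\<Sum>i\<in>I. c i / \<nu> * (exp (g * \<nu>) - 1))"
    by (intro sum_mono exp_minus_one_le_chord c \<nu>)
  also have "\<dots> = (\<Sum>x\<in>I. V x x) / \<nu> * (exp (g * \<nu>) - 1)"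
    unfolding trace_eigsys(1)[OF W] by (simp add: sum_distrib_right sum_divide_distrib)
  also have "\<dots> \<le> (\<Sum>x\<in>I. V x x) / \<nu> * exp (g * \<nu>)"
    unfolding trace_eigsys(1)[OF W] using c \<nu> by (intro mult_left_mono divide_nonneg_nonneg sum_nonneg) auto
  finally have EZ: "expectation Z \<le> (\<Sum>x\<in>I. V x x) / \<nu> * exp (g * \<nu>)" by simp
  \<comment> \<open>\<open>A\<close> is enlarged to an event defined by \<open>Z\<close>, whose
    measurability follows from that of the entries.\<close>
  have "measure M A \<le> measure M {w \<in> space M. \<psi> t \<le> Z w}"
    using A(1) Zt borel_measurable_integrable[OF int_Z] by (intro finite_measure_mono) auto
  also have "\<dots> \<le> expectation Z / \<psi> t"
    by (intro integral_Markov_inequality_measure[where A = "{}"] int_Z \<psi>t AE_I2) (auto simp: Z0)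
  also have "\<dots> \<le> (\<Sum>x\<in>I. V x x) / \<nu> * exp (g * \<nu>) / \<psi> t"
    using EZ \<psi>t by (intro divide_right_mono) auto
  also have "\<dots> \<le> (\<Sum>x\<in>I. V x x) / \<nu> * exp (g * \<nu>) * (4 * exp (- (\<theta> * t)))"
  proof -
    have "1 / \<psi> t \<le> 4 * exp (- (\<theta> * t))"
      using exp_ratio_bound[OF \<theta>t1] \<psi>t by (simp add: exp_minus field_simps \<psi>_def)
    moreover have "0 \<le> (\<Sum>x\<in>I. V x x) / \<nu> * exp (g * \<nu>)"
      unfolding trace_eigsys(1)[OF W] using c \<nu> by (intro mult_nonneg_nonneg divide_nonneg_nonneg sum_nonneg) auto
    ultimately show ?thesis using mult_left_mono by fastforce
  qed
  also have "\<dots> = 4 * ((\<Sum>x\<in>I. V x x) / \<nu>) * exp (g * \<nu> - \<theta> * t)"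
    by (simp add: exp_diff exp_minus field_simps)
  also have "g * \<nu> - \<theta> * t = - (t\<^sup>2) / 2 / \<sigma>"
    unfolding g\<nu> by (simp add: \<theta>_def power2_eq_square field_simps)
  finally show ?thesis by (simp add: \<sigma>_def)
qed

end

section \<open>Einstein eigenvalues\<close>

lemma finite_tidx: "finite (tidx p d)"
  unfolding tidx_def using finite_lists_length_eq[of "{..<d}" p] by (simp add: conj_commute)

lemma card_tidx: "card (tidx p d) = d ^ p"
  using card_lists_length_eq[of "{..<d}" p] by (simp add: tidx_def conj_commute)

lemma tidx_nonempty: "0 < d \<Longrightarrow> tidx p d \<noteq> {}"
  using card_tidx[of p d] by auto

lemma tidx_append: "is \<in> tidx p d \<Longrightarrow> js \<in> tidx q d \<Longrightarrow> is @ js \<in> tidx (p + q) d"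
  by (auto simp: tidx_def)

lemma idx_digits_Suc: "idx_digits d (Suc p) i = (i mod d) # idx_digits d p (i div d)"
proof -
  have "[0..<Suc p] = 0 # map Suc [0..<p]"
    by (simp only: upt_conv_Cons[OF zero_less_Suc] map_Suc_upt)
  then show ?thesis
    by (simp add: idx_digits_def div_mult2_eq del: upt_Suc)
qed

text \<open>Injectivity follows by splitting off the least significant digit, surjectivity by
  counting.\<close>

lemma bij_idx_digits:
  assumes "0 < d"
  shows "bij_betw (idx_digits d p) {..<d ^ p} (tidx p d)"
proof -
  have "inj_on (idx_digits d p) {..<d ^ p}"
  proof (induction p)
    case (Suc p)
    show ?case
    proof (rule inj_onI)
      fix i j assume ij: "i \<in> {..<d ^ Suc p}" "j \<in> {..<d ^ Suc p}"
        and eq: "idx_digits d (Suc p) i = idx_digits d (Suc p) j"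
      have "i div d \<in> {..<d ^ p}" "j div d \<in> {..<d ^ p}"
        using ij assms by (auto simp: less_mult_imp_div_less mult.commute)
      with eq Suc have "i div d = j div d" by (auto simp: idx_digits_Suc dest: inj_onD)
      moreover have "i mod d = j mod d" using eq by (simp add: idx_digits_Suc)
      ultimately show "i = j" by (metis div_mult_mod_eq)
    qed
  qed (simp add: inj_on_def)
  moreover have "idx_digits d p ` {..<d ^ p} \<subseteq> tidx p d"
    using assms by (auto simp: idx_digits_def tidx_def)
  ultimately show ?thesis
    unfolding bij_betw_def using card_tidx finite_tidx
    by (metis card_image card_lessThan card_subset_eq)
qed

text \<open>The link between roots of the characteristic polynomial and the spectral theorem for
  kernels. The eigenvectors as columns diagonalize the unfolding by similarity, and a diagonal
  matrix shows its eigenvalues with multiplicity.\<close>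

lemma e_eigs_eigsys:
  assumes d: "0 < d" and U: "eigsys (tidx p d) (\<lambda>is js. C (is @ js)) U a"
  shows "e_eigs p d C = image_mset a (mset_set (tidx p d))"
proof -
  define n where "n = d ^ p"
  define \<phi> where "\<phi> = idx_digits d p"
  have bij: "bij_betw \<phi> {0..<n} (tidx p d)"
    using bij_idx_digits[OF d] by (simp add: n_def \<phi>_def atLeast0LessThan)
  have \<phi>: "\<phi> i \<in> tidx p d" if "i < n" for i
    using bij_betwE[OF bij] that by auto
  have \<phi>_eq: "\<phi> i = \<phi> j \<longleftrightarrow> i = j" if "i < n" "j < n" for i j
    using bij_betw_imp_inj_on[OF bij] that by (auto dest: inj_onD)
  have re: "(\<Sum>k = 0..<n. f (\<phi> k)) = sum f (tidx p d)" for f :: "nat list \<Rightarrow> real"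
    by (rule sum.reindex_bij_betw[OF bij])
  define A where "A = unfold_mat p d C"
  define B where "B = mat n n (\<lambda>(i, j). if i = j then a (\<phi> i) else 0)"
  define P where "P = mat n n (\<lambda>(i, j). U (\<phi> j) (\<phi> i))"
  define Q where "Q = mat n n (\<lambda>(i, j). U (\<phi> i) (\<phi> j))"
  have carr: "A \<in> carrier_mat n n" "B \<in> carrier_mat n n" "P \<in> carrier_mat n n" "Q \<in> carrier_mat n n"
    by (simp_all add: A_def unfold_mat_def n_def B_def P_def Q_def)
  have PB: "P * B = mat n n (\<lambda>(i, j). a (\<phi> j) * U (\<phi> j) (\<phi> i))"
  proof (rule eq_matI)
    fix i j assume "i < dim_row (mat n n (\<lambda>(i, j). a (\<phi> j) * U (\<phi> j) (\<phi> i)))"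
      "j < dim_col (mat n n (\<lambda>(i, j). a (\<phi> j) * U (\<phi> j) (\<phi> i)))"
    then have ij: "i < n" "j < n" by auto
    have "(P * B) $$ (i, j) = (\<Sum>k = 0..<n. if k = j then U (\<phi> k) (\<phi> i) * a (\<phi> k) else 0)"
      using ij by (simp add: P_def B_def scalar_prod_def if_distrib cong: if_cong)
    then show "(P * B) $$ (i, j) = mat n n (\<lambda>(i, j). a (\<phi> j) * U (\<phi> j) (\<phi> i)) $$ (i, j)"
      using ij by simp
  qed (simp_all add: P_def B_def)
  have "similar_mat_wit A B P Q"
    unfolding similar_mat_wit_def Let_def
  proof (intro conjI)
    show "{A, B, P, Q} \<subseteq> carrier_mat (dim_row A) (dim_row A)" using carr by auto
    \<comment> \<open>This product is the completeness relation of the eigenvectors;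
      \<open>Q * P\<close> below is their orthonormality.\<close>
    have "P * Q = 1\<^sub>m n"
    proof (rule eq_matI)
      fix i j assume "i < dim_row (1\<^sub>m n :: real mat)" "j < dim_col (1\<^sub>m n :: real mat)"
      then have ij: "i < n" "j < n" by auto
      have "(P * Q) $$ (i, j) = (\<Sum>k = 0..<n. U (\<phi> k) (\<phi> i) * U (\<phi> k) (\<phi> j))"
        using ij by (simp add: P_def Q_def scalar_prod_def)
      also have "\<dots> = (if \<phi> i = \<phi> j then 1 else 0)"
        using re[of "\<lambda>k. U k (\<phi> i) * U k (\<phi> j)"] orthonormal_complete[OF eigsysD(1,2)[OF U] \<phi>[OF ij(1)] \<phi>[OF ij(2)]]
        by simp
      finally show "(P * Q) $$ (i, j) = 1\<^sub>m n $$ (i, j)" using ij by (simp add: \<phi>_eq)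
    qed (simp_all add: P_def Q_def)
    then show "P * Q = 1\<^sub>m (dim_row A)" using carr by simp
    have "Q * P = 1\<^sub>m n"
    proof (rule eq_matI)
      fix i j assume "i < dim_row (1\<^sub>m n :: real mat)" "j < dim_col (1\<^sub>m n :: real mat)"
      then have ij: "i < n" "j < n" by auto
      have "(Q * P) $$ (i, j) = (\<Sum>k = 0..<n. U (\<phi> i) (\<phi> k) * U (\<phi> j) (\<phi> k))"
        using ij by (simp add: P_def Q_def scalar_prod_def)
      also have "\<dots> = (if \<phi> i = \<phi> j then 1 else 0)"
        using re[of "\<lambda>k. U (\<phi> i) k * U (\<phi> j) k"] eigsysD(2)[OF U] \<phi>[OF ij(1)] \<phi>[OF ij(2)]
        by (simp add: orthonormal_on_def ip_def)
      finally show "(Q * P) $$ (i, j) = 1\<^sub>m n $$ (i, j)" using ij by (simp add: \<phi>_eq)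
    qed (simp_all add: P_def Q_def)
    then show "Q * P = 1\<^sub>m (dim_row A)" using carr by simp
    show "A = P * B * Q"
    proof (rule eq_matI)
      fix i j assume "i < dim_row (P * B * Q)" "j < dim_col (P * B * Q)"
      then have ij: "i < n" "j < n" using carr by auto
      have "(P * B * Q) $$ (i, j) = (\<Sum>k = 0..<n. a (\<phi> k) * U (\<phi> k) (\<phi> i) * U (\<phi> k) (\<phi> j))"
        unfolding PB using ij by (simp add: Q_def scalar_prod_def)
      also have "\<dots> = C (\<phi> i @ \<phi> j)"
        using re[of "\<lambda>k. a k * U k (\<phi> i) * U k (\<phi> j)"] eigsysD(3)[OF U \<phi>[OF ij(1)] \<phi>[OF ij(2)]]
        by simp
      finally show "A $$ (i, j) = (P * B * Q) $$ (i, j)"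
        using ij by (simp add: A_def unfold_mat_def n_def \<phi>_def)
    qed (use carr in auto)
  qed
  then have "char_poly A = char_poly B"
    by (intro char_poly_similar) (auto simp: similar_mat_def)
  also have "\<dots> = (\<Prod>x\<leftarrow>diag_mat B. [:- x, 1:])"
    by (rule char_poly_upper_triangular[OF carr(2)]) (simp add: upper_triangular_def B_def)
  also have "diag_mat B = map (\<lambda>i. a (\<phi> i)) [0..<n]"
    by (simp add: diag_mat_def B_def)
  also have "proots (\<Prod>x\<leftarrow>map (\<lambda>i. a (\<phi> i)) [0..<n]. [:- x, 1:]) = mset (map (\<lambda>i. a (\<phi> i)) [0..<n])"
  proof -
    have "proots (\<Prod>x\<leftarrow>xs. [:- x, 1:]) = mset xs" for xs :: "real list"
    proof (induction xs)
      case (Cons x xs)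
      have "(\<Prod>x\<leftarrow>xs. [:- x, 1:]) \<noteq> 0" by (auto simp: prod_list_zero_iff)
      then show ?case using Cons by (simp add: proots_mult del: mult_pCons_left)
    qed simp
    then show ?thesis .
  qed
  also have "\<dots> = image_mset a (image_mset \<phi> (mset_set {0..<n}))"
    by (simp add: multiset.map_comp comp_def)
  also have "image_mset \<phi> (mset_set {0..<n}) = mset_set (tidx p d)"
    using bij by (simp add: image_mset_mset_set bij_betw_def)
  finally show ?thesis by (simp add: e_eigs_def A_def)
qed

context
  fixes p d :: nat and C :: tensor
  assumes d: "0 < d" and sym: "einstein_sym p d C"
begin

lemma unfolding_symmetric: "symmetric_on (tidx p d) (\<lambda>is js. C (is @ js))"
  using sym by (simp add: symmetric_on_def einstein_sym_def)

lemma unfolding_eigsys: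
  obtains U a where "eigsys (tidx p d) (\<lambda>is js. C (is @ js)) U a"
    "e_eigs p d C = image_mset a (mset_set (tidx p d))"
proof -
  obtain U a where U: "eigsys (tidx p d) (\<lambda>is js. C (is @ js)) U a"
    using spectral_theorem[OF finite_tidx unfolding_symmetric] by blast
  show thesis by (rule that[OF U e_eigs_eigsys[OF d U]])
qed

lemma e_trace_eq: "e_trace p d C = (\<Sum>is\<in>tidx p d. C (is @ is))"
proof -
  obtain U a where U: "eigsys (tidx p d) (\<lambda>is js. C (is @ js)) U a"
    and e: "e_eigs p d C = image_mset a (mset_set (tidx p d))" by (rule unfolding_eigsys)
  show ?thesis using trace_eigsys(1)[OF U] by (simp add: e_trace_def e sum_unfold_sum_mset)
qed

lemma bil_le_e_norm:
  "bil (tidx p d) (\<lambda>is js. C (is @ js)) v v \<le> e_norm p d C * ip (tidx p d) v v"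
proof -
  obtain U a where U: "eigsys (tidx p d) (\<lambda>is js. C (is @ js)) U a"
    and e: "e_eigs p d C = image_mset a (mset_set (tidx p d))" by (rule unfolding_eigsys)
  have "a i \<le> e_norm p d C" if "i \<in> tidx p d" for i
  proof -
    have "\<bar>a i\<bar> \<le> e_norm p d C"
      unfolding e_norm_def e using that finite_tidx by (intro Max_ge) auto
    then show ?thesis by simp
  qed
  then have "bil (tidx p d) (\<lambda>is js. C (is @ js)) v v
      \<le> (\<Sum>i\<in>tidx p d. e_norm p d C * (ip (tidx p d) (U i) v * ip (tidx p d) (U i) v))"
    unfolding bil_eigsys[OF U] by (intro sum_mono mult_right_mono) auto
  then show ?thesis
    by (simp add: sum_distrib_left[symmetric] parseval[OF eigsysD(1,2)[OF U]])
qed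

lemma e_norm_nonneg: "0 \<le> e_norm p d C"
proof -
  obtain U a where e: "e_eigs p d C = image_mset a (mset_set (tidx p d))" by (rule unfolding_eigsys)
  \<comment> \<open>\<open>Max\<close> is meaningful only on a nonempty set, which
    \<open>d > 0\<close> provides.\<close>
  obtain i where "i \<in> tidx p d" using tidx_nonempty[OF d] by blast
  then have "\<bar>a i\<bar> \<le> e_norm p d C"
    unfolding e_norm_def e using finite_tidx by (intro Max_ge) auto
  then show ?thesis by simp
qed

lemma e_psd_bil_nonneg:
  assumes "e_psd p d C"
  shows "0 \<le> bil (tidx p d) (\<lambda>is js. C (is @ js)) v v"
proof -
  obtain U a where U: "eigsys (tidx p d) (\<lambda>is js. C (is @ js)) U a"
    and e: "e_eigs p d C = image_mset a (mset_set (tidx p d))" by (rule unfolding_eigsys)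
  then show ?thesis
    using assms finite_tidx by (auto simp: bil_eigsys[OF U] e_psd_def e intro!: sum_nonneg)
qed

text \<open>For a positive semidefinite form the eigenvalue of largest modulus is itself
  nonnegative, so the norm is a value of the form at an eigenvector.\<close>

lemma e_norm_attained:
  assumes psd: "\<And>v. 0 \<le> bil (tidx p d) (\<lambda>is js. C (is @ js)) v v"
  obtains v where "ip (tidx p d) v v = 1" "bil (tidx p d) (\<lambda>is js. C (is @ js)) v v = e_norm p d C"
proof -
  obtain U a where U: "eigsys (tidx p d) (\<lambda>is js. C (is @ js)) U a"
    and e: "e_eigs p d C = image_mset a (mset_set (tidx p d))" by (rule unfolding_eigsys)
  have "e_norm p d C \<in> abs ` set_mset (e_eigs p d C)"
    unfolding e_norm_def e using finite_tidx tidx_nonempty[OF d] by (intro Max_in) auto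
  then obtain i where i: "i \<in> tidx p d" "e_norm p d C = \<bar>a i\<bar>"
    using finite_tidx by (auto simp: e)
  have "bil (tidx p d) (\<lambda>is js. C (is @ js)) (U i) (U i) = a i" by (rule bil_eigvec[OF U i(1)])
  moreover have "ip (tidx p d) (U i) (U i) = 1"
    using eigsysD(2)[OF U] i(1) by (simp add: orthonormal_on_def)
  ultimately show thesis using that[of "U i"] psd[of "U i"] i(2) by simp
qed

end

section \<open>Dilation\<close>

text \<open>Row indices and column indices of the rectangular unfolding, kept apart by the disjoint
  sum. For \<open>N = 1\<close> the second part contains only the empty list.\<close>

definition dil_index :: "nat \<Rightarrow> nat \<Rightarrow> (nat list + nat list) set" where
  "dil_index N d = tidx (half_up N) d <+> tidx (N - half_up N) d"

text \<open>The kernel with off-diagonal blocks \<open>A\<close> and its transpose. It is linear in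
  \<open>A\<close>, so dilations of summands add up to the dilation of the sum.\<close>

fun dil :: "tensor \<Rightarrow> nat list + nat list \<Rightarrow> nat list + nat list \<Rightarrow> real" where
  "dil A (Inl is) (Inr ks) = A (is @ ks)"
| "dil A (Inr ks) (Inl is) = A (is @ ks)"
| "dil A _ _ = 0"

fun block_diag :: "tensor \<Rightarrow> tensor \<Rightarrow> nat list + nat list \<Rightarrow> nat list + nat list \<Rightarrow> real" where
  "block_diag B C (Inl is) (Inl js) = B (is @ js)"
| "block_diag B C (Inr ks) (Inr ls) = C (ks @ ls)"
| "block_diag B C _ _ = 0"

lemma finite_dil_index: "finite (dil_index N d)"
  by (simp add: dil_index_def finite_tidx)

lemma sum_dil_index:
  "(\<Sum>x\<in>dil_index N d. f x)
    = (\<Sum>is\<in>tidx (half_up N) d. f (Inl is)) + (\<Sum>ks\<in>tidx (N - half_up N) d. f (Inr ks))"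
  unfolding dil_index_def by (simp add: sum.Plus finite_tidx)

lemma ip_dil_index:
  "ip (dil_index N d) u v = ip (tidx (half_up N) d) (\<lambda>is. u (Inl is)) (\<lambda>is. v (Inl is))
    + ip (tidx (N - half_up N) d) (\<lambda>ks. u (Inr ks)) (\<lambda>ks. v (Inr ks))"
  by (simp add: ip_def sum_dil_index)

lemma symmetric_dil: "symmetric_on (dil_index N d) (dil A)"
  unfolding symmetric_on_def
proof (intro ballI)
  fix x y show "dil A x y = dil A y x" by (cases x; cases y) simp_all
qed

lemma half_up_le: "1 \<le> N \<Longrightarrow> half_up N \<le> N"
  by (simp add: half_up_def)

lemma ebar_append:
  "is \<in> tidx (half_up N) d \<Longrightarrow>
    ebar N d A A (is @ js) = (\<Sum>ks\<in>tidx (N - half_up N) d. A (is @ ks) * A (js @ ks))"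
  by (simp add: ebar_def tidx_def)

lemma eunder_append:
  "ks \<in> tidx (N - half_up N) d \<Longrightarrow>
    eunder N d A A (ks @ ls) = (\<Sum>is\<in>tidx (half_up N) d. A (is @ ks) * A (is @ ls))"
  by (simp add: eunder_def tidx_def)

lemma einstein_sym_ebar: "einstein_sym (half_up N) d (ebar N d A A)"
  by (simp add: einstein_sym_def ebar_append mult.commute)

lemma dil_square:
  assumes "x \<in> dil_index N d" "y \<in> dil_index N d"
  shows "(\<Sum>z\<in>dil_index N d. dil A x z * dil A z y) = block_diag (ebar N d A A) (eunder N d A A) x y"
  unfolding sum_dil_index using assms
  by (cases x; cases y) (auto simp: dil_index_def ebar_append eunder_append)

lemma bil_dil:
  "bil (dil_index N d) (dil A) v v = 2 * (\<Sum>ks\<in>tidx (N - half_up N) d.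
    (\<Sum>is\<in>tidx (half_up N) d. A (is @ ks) * v (Inl is)) * v (Inr ks))"
proof -
  let ?S = "\<Sum>ks\<in>tidx (N - half_up N) d. \<Sum>is\<in>tidx (half_up N) d. A (is @ ks) * v (Inl is) * v (Inr ks)"
  have "bil (dil_index N d) (dil A) v v
      = (\<Sum>is\<in>tidx (half_up N) d. \<Sum>ks\<in>tidx (N - half_up N) d. A (is @ ks) * v (Inl is) * v (Inr ks)) + ?S"
    by (simp add: bil_def sum_dil_index mult_ac)
  also have "(\<Sum>is\<in>tidx (half_up N) d. \<Sum>ks\<in>tidx (N - half_up N) d. A (is @ ks) * v (Inl is) * v (Inr ks)) = ?S"
    by (rule sum.swap)
  finally show ?thesis by (simp add: sum_distrib_right)
qed

text \<open>\<open>ebar\<close> is the unfolding times its transpose, so its form is a squared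
  length. Consequently \<open>gen_norm\<close> is the largest singular value of the
  unfolding.\<close>

lemma bil_ebar:
  "bil (tidx (half_up N) d) (\<lambda>is js. ebar N d A A (is @ js)) v v
    = (\<Sum>ks\<in>tidx (N - half_up N) d. (\<Sum>is\<in>tidx (half_up N) d. A (is @ ks) * v is)\<^sup>2)"
proof -
  let ?J = "tidx (half_up N) d" and ?K = "tidx (N - half_up N) d"
  have "bil ?J (\<lambda>is js. ebar N d A A (is @ js)) v v
      = bil ?J (\<lambda>is js. \<Sum>ks\<in>?K. A (is @ ks) * A (js @ ks)) v v"
    unfolding bil_def by (intro sum.cong refl) (simp add: ebar_append)
  also have "\<dots> = (\<Sum>ks\<in>?K. bil ?J (\<lambda>is js. A (is @ ks) * A (js @ ks)) v v)"
    by (rule bil_sum)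
  also have "\<dots> = (\<Sum>ks\<in>?K. (\<Sum>is\<in>?J. A (is @ ks) * v is)\<^sup>2)"
    by (simp add: bil_def power2_eq_square sum_product mult_ac)
  finally show ?thesis .
qed

text \<open>Cauchy-Schwarz bounds the form by \<open>2 L sqrt (a b)\<close>, and the
  arithmetic-geometric mean inequality by \<open>L (a + b)\<close>. Everything is squared to avoid
  roots.\<close>

lemma abs_bil_dil_le:
  assumes d: "0 < d" and L: "gen_norm N d A \<le> L"
  shows "\<bar>bil (dil_index N d) (dil A) v v\<bar> \<le> L * ip (dil_index N d) v v"
proof -
  let ?J = "tidx (half_up N) d" and ?K = "tidx (N - half_up N) d"
  define p where "p ks = (\<Sum>is\<in>?J. A (is @ ks) * v (Inl is))" for ks
  define a where "a = ip ?J (\<lambda>is. v (Inl is)) (\<lambda>is. v (Inl is))"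
  define b where "b = ip ?K (\<lambda>ks. v (Inr ks)) (\<lambda>ks. v (Inr ks))"
  have ab: "0 \<le> a" "0 \<le> b" by (simp_all add: a_def b_def ip_self_nonneg)
  have e0: "0 \<le> e_norm (half_up N) d (ebar N d A A)"
    by (rule e_norm_nonneg[OF d einstein_sym_ebar])
  then have L0: "0 \<le> L" using L unfolding gen_norm_def by (metis order_trans real_sqrt_ge_zero)
  have "e_norm (half_up N) d (ebar N d A A) \<le> L\<^sup>2"
    using power_mono[OF L, of 2] e0 by (simp add: gen_norm_def)
  then have p: "(\<Sum>ks\<in>?K. (p ks)\<^sup>2) \<le> L\<^sup>2 * a"
    using bil_le_e_norm[OF d einstein_sym_ebar, of N A "\<lambda>is. v (Inl is)"] mult_right_mono[OF _ ab(1)]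
    unfolding bil_ebar p_def a_def by fastforce
  have "(2 * (\<Sum>ks\<in>?K. p ks * v (Inr ks)))\<^sup>2 \<le> 4 * ((\<Sum>ks\<in>?K. (p ks)\<^sup>2) * (\<Sum>ks\<in>?K. (v (Inr ks))\<^sup>2))"
    using Cauchy_Schwarz_ineq_sum[of p "\<lambda>ks. v (Inr ks)" ?K] by (simp add: power_mult_distrib)
  also have "\<dots> \<le> 4 * ((L\<^sup>2 * a) * b)"
    using p ab by (intro mult_left_mono mult_mono) (auto simp: b_def ip_def power2_eq_square sum_nonneg)
  also have "\<dots> \<le> (L * (a + b))\<^sup>2"
  proof -
    have "4 * (a * b) \<le> (a + b)\<^sup>2"
      using sum_squares_ge_zero[of "a - b" 0] by (simp add: power2_eq_square algebra_simps)
    then have "L\<^sup>2 * (4 * (a * b)) \<le> L\<^sup>2 * (a + b)\<^sup>2" by (rule mult_left_mono) simp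
    then show ?thesis by (simp add: power_mult_distrib mult_ac)
  qed
  finally have "\<bar>2 * (\<Sum>ks\<in>?K. p ks * v (Inr ks))\<bar> \<le> \<bar>L * (a + b)\<bar>"
    by (simp only: abs_le_square_iff)
  then show ?thesis
    using L0 ab by (simp add: bil_dil p_def[symmetric] ip_dil_index a_def[symmetric] b_def[symmetric] abs_mult)
qed

lemma exists_bil_dil_ge:
  assumes d: "0 < d" and t: "0 < t" "t \<le> gen_norm N d A"
  shows "\<exists>v. ip (dil_index N d) v v = 1 \<and> t \<le> bil (dil_index N d) (dil A) v v"
proof -
  let ?J = "tidx (half_up N) d" and ?K = "tidx (N - half_up N) d"
  define g where "g = gen_norm N d A"
  have g: "0 < g" using t by (simp add: g_def)
  have g2: "g\<^sup>2 = e_norm (half_up N) d (ebar N d A A)"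
    using e_norm_nonneg[OF d einstein_sym_ebar] by (simp add: g_def gen_norm_def)
  have "0 \<le> bil ?J (\<lambda>is js. ebar N d A A (is @ js)) v v" for v
    unfolding bil_ebar by (simp add: sum_nonneg)
  then obtain u where u: "ip ?J u u = 1" "bil ?J (\<lambda>is js. ebar N d A A (is @ js)) u u = g\<^sup>2"
    unfolding g2 using e_norm_attained[OF d einstein_sym_ebar] by blast
  define p where "p ks = (\<Sum>is\<in>?J. A (is @ ks) * u is)" for ks
  have p: "(\<Sum>ks\<in>?K. p ks * p ks) = g * g"
    using u(2) unfolding bil_ebar p_def by (simp add: power2_eq_square)
  define c where "c = 1 / sqrt 2"
  have c: "c * c = 1 / 2" by (simp add: c_def)
  \<comment> \<open>The eigenvector of the dilation built from a top singular pair: \<open>u\<close>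
    on the rows and \<open>p / g\<close>, its image of unit length, on the columns, both scaled by
    \<open>1 / sqrt 2\<close>.\<close>
  define v where "v = (\<lambda>x. case x of Inl is \<Rightarrow> c * u is | Inr ks \<Rightarrow> c / g * p ks)"
  have "ip (dil_index N d) v v = c * c * ip ?J u u + c * c / (g * g) * (\<Sum>ks\<in>?K. p ks * p ks)"
    unfolding ip_dil_index v_def by (simp add: ip_def sum_distrib_left mult_ac)
  also have "\<dots> = 1" using g by (simp add: u c p)
  finally have "ip (dil_index N d) v v = 1" .
  moreover have pc: "(\<Sum>is\<in>?J. A (is @ ks) * (c * u is)) = c * p ks" for ks
    by (simp add: p_def sum_distrib_left mult_ac)
  have "bil (dil_index N d) (dil A) v v = 2 * (c * c) / g * (\<Sum>ks\<in>?K. p ks * p ks)"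
    by (simp add: bil_dil v_def pc) (simp add: sum_distrib_left sum_divide_distrib mult_ac)
  then have "bil (dil_index N d) (dil A) v v = g" using g by (simp add: c p)
  ultimately show ?thesis using t(2) by (auto simp: g_def)
qed

lemma bil_block_diag:
  "bil (dil_index N d) (block_diag B C) v v
    = bil (tidx (half_up N) d) (\<lambda>is js. B (is @ js)) (\<lambda>is. v (Inl is)) (\<lambda>is. v (Inl is))
      + bil (tidx (N - half_up N) d) (\<lambda>ks ls. C (ks @ ls)) (\<lambda>ks. v (Inr ks)) (\<lambda>ks. v (Inr ks))"
  by (simp add: bil_def sum_dil_index)

lemma symmetric_block_diag:
  assumes "einstein_sym (half_up N) d B" "einstein_sym (N - half_up N) d C"
  shows "symmetric_on (dil_index N d) (block_diag B C)"
  unfolding symmetric_on_def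
proof (intro ballI)
  fix x y assume "x \<in> dil_index N d" "y \<in> dil_index N d"
  then show "block_diag B C x y = block_diag B C y x"
    using assms by (cases x; cases y) (auto simp: dil_index_def einstein_sym_def)
qed

lemma e_geq_bil_le:
  assumes "0 < d" "einstein_sym p d B" "einstein_sym p d C" "e_geq p d B C"
  shows "bil (tidx p d) (\<lambda>is js. C (is @ js)) v v \<le> bil (tidx p d) (\<lambda>is js. B (is @ js)) v v"
proof -
  have "einstein_sym p d (\<lambda>xs. B xs - C xs)"
    using assms(2,3) by (simp add: einstein_sym_def)
  from e_psd_bil_nonneg[OF assms(1) this, of v] assms(4)
  show ?thesis by (simp add: e_geq_def bil_def algebra_simps sum_subtractf)
qed

section \<open>From random kernels back to random tensors\<close>

lemma dil_measurable:
  assumes N: "1 \<le> N"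
  shows "(\<lambda>f. restrict (\<lambda>(x, y). dil f x y) (dil_index N d \<times> dil_index N d))
    \<in> measurable (Pi\<^sub>M (tidx N d) (\<lambda>_. borel)) (Pi\<^sub>M (dil_index N d \<times> dil_index N d) (\<lambda>_. borel))"
proof (rule measurable_restrict)
  fix xy assume xy: "xy \<in> dil_index N d \<times> dil_index N d"
  have c: "(\<lambda>f. f (is @ ks)) \<in> borel_measurable (Pi\<^sub>M (tidx N d) (\<lambda>_. borel :: real measure))"
    if "is \<in> tidx (half_up N) d" "ks \<in> tidx (N - half_up N) d" for "is" ks
    using tidx_append[OF that] half_up_le[OF N] by (intro measurable_component_singleton) simp
  obtain x y where "xy = (x, y)" by (cases xy)
  with xy show "(\<lambda>f. case xy of (x, y) \<Rightarrow> dil f x y) \<in> borel_measurable (Pi\<^sub>M (tidx N d) (\<lambda>_. borel))"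
    by (cases x; cases y) (auto simp: dil_index_def c)
qed

theorem theorem5p5:
  fixes M :: "'w measure" and N d n :: nat and X :: "nat \<Rightarrow> 'w \<Rightarrow> tensor"
    and L t :: real and V1 V2 :: tensor
  assumes "prob_space M"
    and "N \<ge> 1" and "d \<ge> 1"
    and meas: "\<And>k xs. k < n \<Longrightarrow> xs \<in> tidx N d \<Longrightarrow> (\<lambda>w. X k w xs) \<in> borel_measurable M"
    and indep: "prob_space.indep_vars M (\<lambda>_. Pi\<^sub>M (tidx N d) (\<lambda>_. borel))
                  (\<lambda>k w. restrict (X k w) (tidx N d)) {..<n}"
    and "L \<ge> 0"
    and mean0: "\<And>k xs. k < n \<Longrightarrow> xs \<in> tidx N d \<Longrightarrow> texp M (X k) xs = 0"
    and bound: "\<And>k w. k < n \<Longrightarrow> w \<in> space M \<Longrightarrow> gen_norm N d (X k w) \<le> L"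
    and sym1: "einstein_sym (half_up N) d V1"
    and sym2: "einstein_sym (N - half_up N) d V2"
    and V1: "e_geq (half_up N) d V1
               (texp M (\<lambda>w. ebar N d (\<lambda>xs. \<Sum>k<n. X k w xs) (\<lambda>xs. \<Sum>k<n. X k w xs)))"
    and V2: "e_geq (N - half_up N) d V2
               (texp M (\<lambda>w. eunder N d (\<lambda>xs. \<Sum>k<n. X k w xs) (\<lambda>xs. \<Sum>k<n. X k w xs)))"
    and nupos: "max (e_norm (half_up N) d V1) (e_norm (N - half_up N) d V2) > 0"
    and t: "t \<ge> sqrt (max (e_norm (half_up N) d V1) (e_norm (N - half_up N) d V2)) + L / 3"
  shows "measure M {w \<in> space M. gen_norm N d (\<lambda>xs. \<Sum>k<n. X k w xs) \<ge> t}
     \<le> 4 * ((e_trace (half_up N) d V1 + e_trace (N - half_up N) d V2)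
               / max (e_norm (half_up N) d V1) (e_norm (N - half_up N) d V2))
         * exp ((- (t ^ 2) / 2)
               / (max (e_norm (half_up N) d V1) (e_norm (N - half_up N) d V2) + L * t / 3))"
proof -
  interpret prob_space M by fact
  note N = \<open>N \<ge> 1\<close>
  have d: "0 < d" using \<open>d \<ge> 1\<close> by simp
  let ?I = "dil_index N d" and ?J = "tidx (half_up N) d" and ?K = "tidx (N - half_up N) d"
  let ?Y = "\<lambda>w xs. \<Sum>k<n. X k w xs"
  define \<nu> where "\<nu> = max (e_norm (half_up N) d V1) (e_norm (N - half_up N) d V2)"
  \<comment> \<open>Subtraction on \<open>nat\<close> truncates; \<open>half_up N \<le> N\<close>
    makes the two lengths add up to \<open>N\<close>.\<close>
  have append: "is @ ks \<in> tidx N d" if "is \<in> ?J" "ks \<in> ?K" for "is" ks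
    using tidx_append[OF that] half_up_le[OF N] by simp
  interpret D: indep_kernels M ?I n "\<lambda>k w. dil (X k w)" L
  proof
    show "finite ?I" by (rule finite_dil_index)
    \<comment> \<open>The dilated kernels are independent as images of the independent tensors under
      this one measurable map, which reads only entries indexed by \<open>tidx N d\<close>.\<close>
    let ?h = "\<lambda>f. restrict (\<lambda>(x, y). dil f x y) (?I \<times> ?I)"
    have "indep_vars (\<lambda>_. Pi\<^sub>M (?I \<times> ?I) (\<lambda>_. borel)) (\<lambda>k w. ?h (restrict (X k w) (tidx N d))) {..<n}"
      by (rule indep_vars_compose2[OF indep dil_measurable[OF N]])
    moreover have "?h (restrict (X k w) (tidx N d)) = ?h (X k w)" for k w
    proof (rule restrict_ext)
      fix xy assume xy: "xy \<in> ?I \<times> ?I"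
      obtain x y where "xy = (x, y)" by (cases xy)
      with xy show "(case xy of (x, y) \<Rightarrow> dil (restrict (X k w) (tidx N d)) x y)
          = (case xy of (x, y) \<Rightarrow> dil (X k w) x y)"
        by (cases x; cases y) (auto simp: dil_index_def append)
    qed
    ultimately show "indep_vars (\<lambda>_. Pi\<^sub>M (?I \<times> ?I) (\<lambda>_. borel)) (\<lambda>k w. ?h (X k w)) {..<n}"
      by simp
  next
    fix k w v assume k: "k < n" and w: "w \<in> space M"
    show "symmetric_on ?I (dil (X k w))" by (rule symmetric_dil)
    show "\<bar>bil ?I (dil (X k w)) v v\<bar> \<le> L * ip ?I v v"
      by (rule abs_bil_dil_le[OF d bound[OF k w]])
  next
    fix k x y assume "k < n" "x \<in> ?I" "y \<in> ?I"
    then show "expectation (\<lambda>w. dil (X k w) x y) = 0"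
      using mean0 append by (cases x; cases y) (auto simp: dil_index_def texp_def)
  qed
  have total: "D.total w x y = dil (?Y w) x y" for w x y
    by (cases x; cases y) simp_all
  let ?E1 = "texp M (\<lambda>w. ebar N d (?Y w) (?Y w))" and ?E2 = "texp M (\<lambda>w. eunder N d (?Y w) (?Y w))"
  \<comment> \<open>The hypotheses speak of the two contractions of the whole sum, whereas
    \<open>bernstein_tail\<close> asks for the sum of second moments. The vanishing of cross terms
    and the square of the dilation reconcile them.\<close>
  have moment: "(\<Sum>k<n. D.second_moment k x y) = block_diag ?E1 ?E2 x y" if "x \<in> ?I" "y \<in> ?I" for x y
  proof -
    have "(\<Sum>k<n. D.second_moment k x y) = expectation (\<lambda>w. \<Sum>z\<in>?I. dil (?Y w) x z * dil (?Y w) z y)"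
      using D.second_moment_sum[OF that] by (simp add: total)
    also have "\<dots> = expectation (\<lambda>w. block_diag (ebar N d (?Y w) (?Y w)) (eunder N d (?Y w) (?Y w)) x y)"
      by (simp add: dil_square[OF that])
    also have "\<dots> = block_diag ?E1 ?E2 x y"
      by (cases x; cases y) (simp_all add: texp_def)
    finally show ?thesis .
  qed
  have symE1: "einstein_sym (half_up N) d ?E1"
    by (simp add: einstein_sym_def texp_def ebar_append mult.commute)
  have symE2: "einstein_sym (N - half_up N) d ?E2"
    by (simp add: einstein_sym_def texp_def eunder_append mult.commute)
  have "measure M {w \<in> space M. gen_norm N d (?Y w) \<ge> t}
      \<le> 4 * ((\<Sum>x\<in>?I. block_diag V1 V2 x x) / \<nu>) * exp (- (t\<^sup>2) / 2 / (\<nu> + L * t / 3))"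
  proof (rule D.bernstein_tail[where V = "block_diag V1 V2"])
    show "symmetric_on ?I (block_diag V1 V2)" by (rule symmetric_block_diag[OF sym1 sym2])
    show "0 < \<nu>" "0 \<le> L" "sqrt \<nu> + L / 3 \<le> t" using nupos t \<open>L \<ge> 0\<close> by (simp_all add: \<nu>_def)
    show "bil ?I (\<lambda>x y. \<Sum>k<n. D.second_moment k x y) v v \<le> bil ?I (block_diag V1 V2) v v" for v
    proof -
      have "bil ?I (\<lambda>x y. \<Sum>k<n. D.second_moment k x y) v v = bil ?I (block_diag ?E1 ?E2) v v"
        unfolding bil_def by (intro sum.cong refl) (simp only: moment)
      also have "\<dots> \<le> bil ?I (block_diag V1 V2) v v"
        unfolding bil_block_diag
        by (intro add_mono e_geq_bil_le d sym1 sym2 symE1 symE2 V1 V2)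
      finally show ?thesis .
    qed
    show "bil ?I (block_diag V1 V2) v v \<le> \<nu> * ip ?I v v" for v
    proof -
      have "bil ?I (block_diag V1 V2) v v
          \<le> e_norm (half_up N) d V1 * ip ?J (\<lambda>is. v (Inl is)) (\<lambda>is. v (Inl is))
          + e_norm (N - half_up N) d V2 * ip ?K (\<lambda>ks. v (Inr ks)) (\<lambda>ks. v (Inr ks))"
        unfolding bil_block_diag by (intro add_mono bil_le_e_norm d sym1 sym2)
      also have "\<dots> \<le> \<nu> * ip ?J (\<lambda>is. v (Inl is)) (\<lambda>is. v (Inl is))
          + \<nu> * ip ?K (\<lambda>ks. v (Inr ks)) (\<lambda>ks. v (Inr ks))"
        by (intro add_mono mult_right_mono ip_self_nonneg) (simp_all add: \<nu>_def)
      finally show ?thesis by (simp add: ip_dil_index algebra_simps)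
    qed
    \<comment> \<open>The test vector for the dilation is divided by the norm, so the threshold must
      be strictly positive.\<close>
    have t0: "0 < t"
    proof -
      have "0 < sqrt \<nu>" using nupos by (simp add: \<nu>_def)
      also have "\<dots> \<le> t" using t \<open>L \<ge> 0\<close> unfolding \<nu>_def by linarith
      finally show ?thesis .
    qed
    show "\<exists>v. ip ?I v v = 1 \<and> t \<le> bil ?I (D.total w) v v"
      if "w \<in> {w \<in> space M. gen_norm N d (?Y w) \<ge> t}" for w
      using exists_bil_dil_ge[OF d t0, of N "?Y w"] that unfolding total by simp
  qed auto
  also have "(\<Sum>x\<in>?I. block_diag V1 V2 x x) = e_trace (half_up N) d V1 + e_trace (N - half_up N) d V2"
    by (simp add: sum_dil_index e_trace_eq[OF d sym1] e_trace_eq[OF d sym2])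
  finally show ?thesis by (simp add: \<nu>_def)
qed

end
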